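(* Let $T\colon[0,1]\to[0,1]$ be continuous and topologically mixing. There exist dense Mycielski sets $M_1,M_2,M_3\subset[0,1]$ and numbers $\delta_n>0$ ($n\ge2$) such that: (1) for $i=1,2$ and every $n\ge2$, each $n$-tuple of pairwise distinct points of $M_i$ is $\delta_n$-Li-Yorke; (2) every point of $M_1$ has dense orbit in $[0,1]$; (3) there is a minimal Cantor set $A$ such that $\omega(x,T)=A$ for every $x\in M_2$, and $M_2\cap A$ contains a Cantor set; (4) $M_3\times M_3$ contains no Li-Yorke pairs.
   Context: $T$ is topologically mixing if for all nonempty open $U,V$, $T^n(U)\cap V\ne\emptyset$ for all sufficiently large $n$. A Mycielski set is a countable union of Cantor sets. With $\rho(x,y)=|x-y|$, a tuple is $\delta$-Li-Yorke if $\liminf_n\max_{i,j}\rho(T^nx_i,T^nx_j)=0$ and $\limsup_n\min_{i\ne j}\rho(T^nx_i,T^nx_j)>\delta$; a pair is Li-Yorke if it is $\delta$-Li-Yorke for some $\delta>0$. A minimal set is a nonempty closed invariant set with no proper nonempty closed invariant subset; $\omega(x,T)$ is the $\omega$-limit set. *)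

theory Defs
  imports "HOL-Analysis.Analysis" "HOL-Library.Liminf_Limsup"
begin

text \<open>Interval map setting: T maps [0,1] into itself; all topological notions are relative to [0,1].\<close>

definition topologically_mixing :: "(real \<Rightarrow> real) \<Rightarrow> bool" where
  "topologically_mixing T \<longleftrightarrow>
     (\<forall>U V. openin (top_of_set {0..1}) U \<and> openin (top_of_set {0..1}) V \<and> U \<noteq> {} \<and> V \<noteq> {}
        \<longrightarrow> (\<exists>N. \<forall>n\<ge>N. (T ^^ n) ` U \<inter> V \<noteq> {}))"

definition cantor_set :: "real set \<Rightarrow> bool" where
  "cantor_set C \<longleftrightarrow> C \<noteq> {} \<and> compact C \<and> (\<forall>x\<in>C. x islimpt C)
     \<and> (\<forall>x\<in>C. connected_component_set C x = {x})"

definition mycielski_set :: "real set \<Rightarrow> bool" where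
  "mycielski_set M \<longleftrightarrow> (\<exists>F. countable F \<and> (\<forall>C\<in>F. cantor_set C) \<and> M = \<Union>F)"

text \<open>An n-tuple is a function on {..<n}; rho(x,y) = |x - y|.\<close>
definition delta_li_yorke :: "(real \<Rightarrow> real) \<Rightarrow> real \<Rightarrow> nat \<Rightarrow> (nat \<Rightarrow> real) \<Rightarrow> bool" where
  "delta_li_yorke T \<delta> n x \<longleftrightarrow>
     liminf (\<lambda>k. ereal (Max {\<bar>(T ^^ k) (x i) - (T ^^ k) (x j)\<bar> | i j. i < n \<and> j < n})) = 0
   \<and> limsup (\<lambda>k. ereal (Min {\<bar>(T ^^ k) (x i) - (T ^^ k) (x j)\<bar> | i j. i < n \<and> j < n \<and> i \<noteq> j}))
       > ereal \<delta>"

definition li_yorke_pair :: "(real \<Rightarrow> real) \<Rightarrow> real \<Rightarrow> real \<Rightarrow> bool" where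
  "li_yorke_pair T x y \<longleftrightarrow> (\<exists>\<delta>>0. delta_li_yorke T \<delta> 2 (\<lambda>i. if i = 0 then x else y))"

definition invariant_set :: "(real \<Rightarrow> real) \<Rightarrow> real set \<Rightarrow> bool" where
  "invariant_set T A \<longleftrightarrow> T ` A \<subseteq> A"

definition minimal_set :: "(real \<Rightarrow> real) \<Rightarrow> real set \<Rightarrow> bool" where
  "minimal_set T A \<longleftrightarrow> A \<noteq> {} \<and> closed A \<and> invariant_set T A \<and>
     (\<forall>B. B \<subseteq> A \<and> B \<noteq> {} \<and> closed B \<and> invariant_set T B \<longrightarrow> B = A)"

definition omega_limit :: "(real \<Rightarrow> real) \<Rightarrow> real \<Rightarrow> real set" where
  "omega_limit T x = {y. \<exists>r. strict_mono r \<and> (\<lambda>k. (T ^^ (r k)) x) \<longlonglongrightarrow> y}"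

definition orbit :: "(real \<Rightarrow> real) \<Rightarrow> real \<Rightarrow> real set" where
  "orbit T x = {(T ^^ k) x | k. True}"

end

theory Submission
  imports Defs
begin

text \<open>Mixing forces the image of every nondegenerate interval to cover eventually any given compact
  subinterval of the open unit interval. Choosing preimage intervals compatibly with both the prefix
  order and the shift, one obtains an embedding \<open>h\<close> of the full one-sided 2-shift into some power of
  \<open>T\<close>; it is single-valued because a nondegenerate interval cannot stay small under iteration. Every
  interval contains a section, a Cantor set that some iterate of \<open>T\<close> maps onto the image of \<open>h\<close>
  compatibly with the coding, so families of codes can be spread densely over the unit interval while
  keeping the tails of the orbits.

  For the minimal set, a family of sequences is built by doubling: the block of level \<open>n + 1\<close> of a
  code is its block of level \<open>n\<close> followed by the block of level \<open>n\<close> of a relabelled code, and the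
  relabellings run through all finite lookup tables, each infinitely often. Constant tables give
  proximality and minimality, injective tables give separation of tuples. The set without Li-Yorke
  pairs comes from Toeplitz sequences, for which different codes differ along an arithmetic
  progression. The points with dense orbit are found directly, by prescribing rational intervals to
  be visited, again through all finite lookup tables.\<close>

subsection \<open>Intervals mapped onto intervals\<close>

text \<open>Take \<open>u\<close> as the last point of \<open>{s..t}\<close> with value
  \<open>c\<close> and \<open>v\<close> as the first point after \<open>u\<close> with value
  \<open>d\<close>. A value outside \<open>{c..d}\<close> between them would, by the intermediate
  value theorem, produce a later \<open>c\<close>-point or an earlier
  \<open>d\<close>-point.\<close>

lemma preimage_interval_reduce_ordered:
  fixes f :: "real \<Rightarrow> real"
  assumes cont: "continuous_on {p..q} f" and st: "p \<le> s" "s \<le> t" "t \<le> q"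
    and fs: "f s = c" and ft: "f t = d" and cd: "c \<le> d"
  shows "\<exists>u v. p \<le> u \<and> u \<le> v \<and> v \<le> q \<and> f ` {u..v} = {c..d}"
proof -
  have cst: "continuous_on {s..t} f"
    using cont by (rule continuous_on_subset) (use st in auto)
  let ?A = "{x \<in> {s..t}. f x = c}"
  have "compact ?A"
    using continuous_closed_preimage_constant[OF cst closed_atLeastAtMost]
    by (metis (no_types, lifting) compact_Icc compact_Int_closed inf.absorb2 mem_Collect_eq subsetI)
  moreover have "?A \<noteq> {}" using fs st by auto
  ultimately obtain u where u: "u \<in> ?A" "\<And>x. x \<in> ?A \<Longrightarrow> x \<le> u"
    using compact_attains_sup by meson
  have cut: "continuous_on {u..t} f"
    using cst by (rule continuous_on_subset) (use u in auto)
  let ?B = "{x \<in> {u..t}. f x = d}"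
  have "compact ?B"
    using continuous_closed_preimage_constant[OF cut closed_atLeastAtMost]
    by (metis (no_types, lifting) compact_Icc compact_Int_closed inf.absorb2 mem_Collect_eq subsetI)
  moreover have "?B \<noteq> {}" using ft u by auto
  ultimately obtain v where v: "v \<in> ?B" "\<And>x. x \<in> ?B \<Longrightarrow> v \<le> x"
    using compact_attains_inf by meson
  have uv: "u \<le> v" "v \<le> t" "s \<le> u" using u v by auto
  have cuv: "continuous_on {x..y} f" if "u \<le> x" "y \<le> t" for x y
    using cut by (rule continuous_on_subset) (use that in auto)
  have "f x \<in> {c..d}" if x: "x \<in> {u..v}" for x
  proof -
    have "c \<le> f x"
    proof (rule ccontr)
      assume "\<not> c \<le> f x"
      then obtain y where y: "x \<le> y" "y \<le> v" "f y = c"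
        using IVT'[of f x c v] cuv[of x v] x v(1) cd uv by auto
      then have "y \<le> u" using u(2)[of y] x uv by auto
      then have "y = u" "x = u" using x y by auto
      then show False using \<open>\<not> c \<le> f x\<close> u by auto
    qed
    moreover have "f x \<le> d"
    proof (rule ccontr)
      assume "\<not> f x \<le> d"
      then obtain y where y: "u \<le> y" "y \<le> x" "f y = d"
        using IVT'[of f u d x] cuv[of u x] x u(1) cd uv by auto
      then have "v \<le> y" using v(2)[of y] x uv by auto
      then have "x = v" using x y by auto
      then show False using \<open>\<not> f x \<le> d\<close> v by auto
    qed
    ultimately show ?thesis by auto
  qed
  moreover have "y \<in> f ` {u..v}" if "y \<in> {c..d}" for y
    using IVT'[of f u y v] cuv[of u v] that u(1) v(1) uv by auto
  ultimately have "f ` {u..v} = {c..d}" by blast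
  then show ?thesis using uv st by (intro exI[of _ u] exI[of _ v]) auto
qed

lemma preimage_interval_reduce:
  fixes f :: "real \<Rightarrow> real"
  assumes cont: "continuous_on {p..q} f" and cd: "c \<le> d" and sub: "{c..d} \<subseteq> f ` {p..q}"
  shows "\<exists>u v. p \<le> u \<and> u \<le> v \<and> v \<le> q \<and> f ` {u..v} = {c..d}"
proof -
  obtain s where s: "s \<in> {p..q}" "f s = c" using sub cd by force
  obtain t where t: "t \<in> {p..q}" "f t = d" using sub cd by force
  show ?thesis
  proof (cases "s \<le> t")
    case True
    then show ?thesis using preimage_interval_reduce_ordered[OF cont _ True _ s(2) t(2) cd] s t by auto
  next
    case False
    \<comment> \<open>If the preimages of the endpoints occur in reverse order, the ordered case
      applies to \<open>- f\<close>.\<close>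
    have "continuous_on {p..q} (\<lambda>x. - f x)" using cont by (intro continuous_intros)
    from preimage_interval_reduce_ordered[OF this, of t s "- d" "- c"] False s t cd
    obtain u v where uv: "p \<le> u" "u \<le> v" "v \<le> q" "(\<lambda>x. - f x) ` {u..v} = {- d..- c}" by auto
    have "f ` {u..v} = uminus ` ((\<lambda>x. - f x) ` {u..v})" by (simp add: image_image)
    also have "\<dots> = {c..d}" unfolding uv(4) by simp
    finally show ?thesis using uv by auto
  qed
qed

definition closed_interval :: "real set \<Rightarrow> bool" where
  "closed_interval S \<longleftrightarrow> (\<exists>u v. 0 \<le> u \<and> u \<le> v \<and> v \<le> 1 \<and> S = {u..v})"

lemma closed_intervalD:
  assumes "closed_interval S"
  shows "S \<noteq> {}" "compact S" "connected S" "S \<subseteq> {0..1}"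
  using assms unfolding closed_interval_def by auto

text \<open>The choice is a function of \<open>f\<close>, \<open>J\<close> and \<open>K\<close>
  alone, so codes with equal data receive equal intervals. This keeps each level of the
  constructions below dependent on finitely many bits.\<close>

definition subinterval_onto :: "(real \<Rightarrow> real) \<Rightarrow> real set \<Rightarrow> real set \<Rightarrow> real set" where
  "subinterval_onto f J K = (SOME S. closed_interval S \<and> S \<subseteq> J \<and> f ` S = K)"

lemma subinterval_onto:
  assumes "continuous_on {0..1} f" "closed_interval J" "closed_interval K" "K \<subseteq> f ` J"
  shows "closed_interval (subinterval_onto f J K)" "subinterval_onto f J K \<subseteq> J"
    "f ` subinterval_onto f J K = K"
proof -
  obtain p q where J: "0 \<le> p" "p \<le> q" "q \<le> 1" "J = {p..q}"
    using assms unfolding closed_interval_def by auto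
  obtain c d where K: "c \<le> d" "K = {c..d}"
    using assms unfolding closed_interval_def by auto
  have "continuous_on {p..q} f" using assms(1) by (rule continuous_on_subset) (use J in auto)
  from preimage_interval_reduce[OF this K(1)] assms J K
  obtain u v where uv: "p \<le> u" "u \<le> v" "v \<le> q" "f ` {u..v} = {c..d}" by auto
  have "closed_interval {u..v}" unfolding closed_interval_def using uv J by force
  then have "\<exists>S. closed_interval S \<and> S \<subseteq> J \<and> f ` S = K"
    using uv J K by (intro exI[of _ "{u..v}"]) auto
  then have "closed_interval (subinterval_onto f J K) \<and> subinterval_onto f J K \<subseteq> J
      \<and> f ` subinterval_onto f J K = K"
    unfolding subinterval_onto_def by (rule someI_ex)
  then show "closed_interval (subinterval_onto f J K)" "subinterval_onto f J K \<subseteq> J"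
    "f ` subinterval_onto f J K = K" by auto
qed

subsection \<open>Cantor sets parametrised by binary sequences\<close>

definition agree :: "nat \<Rightarrow> (nat \<Rightarrow> bool) \<Rightarrow> (nat \<Rightarrow> bool) \<Rightarrow> bool" where
  "agree N a b \<longleftrightarrow> (\<forall>i<N. a i = b i)"

text \<open>Uniform continuity on the Cantor space of binary sequences, phrased through cylinders;
  \<open>cylinder_map\<close> is the analogue for maps of that space into itself.\<close>

definition cylinder_continuous :: "((nat \<Rightarrow> bool) \<Rightarrow> real) \<Rightarrow> bool" where
  "cylinder_continuous g \<longleftrightarrow> (\<forall>e>0. \<exists>N. \<forall>a b. agree N a b \<longrightarrow> \<bar>g a - g b\<bar> < e)"

definition cylinder_map :: "((nat \<Rightarrow> bool) \<Rightarrow> (nat \<Rightarrow> bool)) \<Rightarrow> bool" where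
  "cylinder_map \<phi> \<longleftrightarrow> (\<forall>K. \<exists>N. \<forall>a b. agree N a b \<longrightarrow> agree K (\<phi> a) (\<phi> b))"

lemma agree_mono: "agree N a b \<Longrightarrow> M \<le> N \<Longrightarrow> agree M a b"
  by (auto simp: agree_def)

lemma cylinder_continuous_comp:
  assumes "cylinder_continuous g" "cylinder_map \<phi>"
  shows "cylinder_continuous (\<lambda>a. g (\<phi> a))"
  unfolding cylinder_continuous_def
proof (intro allI impI)
  fix e :: real assume "e > 0"
  then obtain K where K: "\<forall>a b. agree K a b \<longrightarrow> \<bar>g a - g b\<bar> < e"
    using assms(1) unfolding cylinder_continuous_def by blast
  obtain N where "\<forall>a b. agree N a b \<longrightarrow> agree K (\<phi> a) (\<phi> b)"
    using assms(2) unfolding cylinder_map_def by blast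
  with K show "\<exists>N. \<forall>a b. agree N a b \<longrightarrow> \<bar>g (\<phi> a) - g (\<phi> b)\<bar> < e" by blast
qed

lemma cylinder_map_comp:
  assumes "cylinder_map \<phi>" "cylinder_map \<psi>"
  shows "cylinder_map (\<lambda>a. \<phi> (\<psi> a))"
  using assms unfolding cylinder_map_def by meson

lemma cylinder_map_coord:
  assumes "\<And>k. \<exists>N. \<forall>a b. agree N a b \<longrightarrow> \<phi> a k = \<phi> b k"
  shows "cylinder_map \<phi>"
  unfolding cylinder_map_def
proof
  fix K
  obtain N where N: "\<And>k a b. agree (N k) a b \<Longrightarrow> \<phi> a k = \<phi> b k"
    using assms by metis
  \<comment> \<open>The largest modulus of the finitely many coordinates works. For
    \<open>K = 0\<close> the maximum over the empty set does no harm, since the claim is then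
    vacuous.\<close>
  have "agree K (\<phi> a) (\<phi> b)" if "agree (Max (N ` {..<K})) a b" for a b
    unfolding agree_def
  proof (intro allI impI)
    fix i assume "i < K"
    then have "N i \<le> Max (N ` {..<K})" by (intro Max_ge) auto
    then show "\<phi> a i = \<phi> b i" using N agree_mono that by blast
  qed
  then show "\<exists>M. \<forall>a b. agree M a b \<longrightarrow> agree K (\<phi> a) (\<phi> b)" by blast
qed

text \<open>The sequence space is compact by Tychonoff, and cylinders are open because they restrict
  finitely many discrete coordinates.\<close>

lemma compact_range_cylinder_continuous:
  assumes "cylinder_continuous g"
  shows "compact (range g)"
proof -
  have "compact_space (product_topology (\<lambda>i::nat. euclidean :: bool topology) UNIV)"
    unfolding compact_space_product_topology
    by (simp add: compact_space_def finite_imp_compact)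
  then have c: "compact (UNIV :: (nat \<Rightarrow> bool) set)"
    unfolding euclidean_product_topology by (simp add: compact_space_def)
  have "continuous_on UNIV g"
    unfolding continuous_on_topological
  proof (intro ballI allI impI)
    fix a :: "nat \<Rightarrow> bool" and B assume B: "open B" "g a \<in> B"
    then obtain e where e: "e > 0" "ball (g a) e \<subseteq> B" using open_contains_ball by blast
    then obtain N where N: "\<forall>a b. agree N a b \<longrightarrow> \<bar>g a - g b\<bar> < e"
      using assms unfolding cylinder_continuous_def by blast
    let ?A = "{b. agree N a b}"
    have "?A = PiE UNIV (\<lambda>i. if i < N then {a i} else UNIV)"
      by (auto simp: agree_def PiE_def Pi_def split: if_splits)
    moreover have "open (PiE UNIV (\<lambda>i. if i < N then {a i} else UNIV))"
    proof (rule open_PiE)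
      have "{i. (if i < N then {a i} else UNIV) \<noteq> UNIV} \<subseteq> {..<N}" by auto
      then show "finite {i. (if i < N then {a i} else UNIV) \<noteq> UNIV}"
        using finite_subset by blast
    qed (auto simp: open_discrete)
    ultimately have "open ?A" by simp
    moreover have "\<forall>y\<in>UNIV. y \<in> ?A \<longrightarrow> g y \<in> B"
      using N e by (auto simp: dist_real_def subset_iff)
    moreover have "a \<in> ?A" by (simp add: agree_def)
    ultimately show "\<exists>A. open A \<and> a \<in> A \<and> (\<forall>y\<in>UNIV. y \<in> A \<longrightarrow> g y \<in> B)" by blast
  qed
  then show ?thesis using c compact_continuous_image by blast
qed

lemma cantor_set_range:
  assumes g: "cylinder_continuous g" and inj: "inj g"
  shows "cantor_set (range g)"
  unfolding cantor_set_def
proof (intro conjI ballI)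
  show "compact (range g)" using g by (rule compact_range_cylinder_continuous)
next
  fix x assume "x \<in> range g"
  then obtain a where a: "x = g a" by auto
  show "x islimpt range g"
    unfolding islimpt_approachable
  proof (intro allI impI)
    fix e :: real assume "e > 0"
    then obtain N where N: "\<forall>a b. agree N a b \<longrightarrow> \<bar>g a - g b\<bar> < e"
      using g unfolding cylinder_continuous_def by blast
    \<comment> \<open>Flipping a bit beyond the modulus moves the point by less than
      \<open>e\<close>, and injectivity ensures that it does move.\<close>
    let ?b = "a(N := \<not> a N)"
    have "a \<noteq> ?b" by (metis fun_upd_same)
    then have "g ?b \<noteq> x" using inj a by (metis injD)
    moreover have "dist (g ?b) x < e"
      using N[rule_format, of ?b a] a by (auto simp: agree_def dist_real_def)
    ultimately show "\<exists>x'\<in>range g. x' \<noteq> x \<and> dist x' x < e" by blast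
  qed
next
  fix x assume x: "x \<in> range g"
  have "y = x" if y: "y \<in> connected_component_set (range g) x" for y
  proof (rule ccontr)
    assume "y \<noteq> x"
    obtain S where S: "connected S" "S \<subseteq> range g" "x \<in> S" "y \<in> S"
      using y unfolding connected_component_def by auto
    obtain a b where ab: "x = g a" "y = g b" using S by blast
    then have "a \<noteq> b" using \<open>y \<noteq> x\<close> by blast
    then obtain i where i: "a i \<noteq> b i" unfolding fun_eq_iff by blast
    \<comment> \<open>The image of the half space where bit \<open>i\<close> equals
      \<open>c\<close>, written as a full range after overwriting that bit, so that compactness of
      ranges applies. The two halves are disjoint closed sets separating \<open>x\<close> from
      \<open>y\<close>.\<close>
    let ?R = "\<lambda>c. range (\<lambda>d. g (d(i := c)))"
    have upd: "cylinder_map (\<lambda>d. d(i := c))" for c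
      by (rule cylinder_map_coord) (auto simp: agree_def intro!: exI[of _ "Suc _"])
    have cl: "closed (?R c)" for c
      using compact_range_cylinder_continuous[OF cylinder_continuous_comp[OF g upd]]
      by (rule compact_imp_closed)
    have disj: "?R (a i) \<inter> ?R (b i) = {}"
    proof (rule ccontr)
      assume "?R (a i) \<inter> ?R (b i) \<noteq> {}"
      then obtain d d' where "g (d(i := a i)) = g (d'(i := b i))" by blast
      then have "(d(i := a i)) i = (d'(i := b i)) i" using inj by (metis injD)
      then show False using i by simp
    qed
    have R: "g d \<in> ?R (d i)" for d by (rule range_eqI[of _ _ d]) simp
    have "S \<subseteq> ?R (a i) \<union> ?R (b i)"
    proof
      fix z assume "z \<in> S"
      then obtain d where d: "z = g d" using S by auto
      have "d i = a i \<or> d i = b i" using i by auto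
      then have "?R (d i) = ?R (a i) \<or> ?R (d i) = ?R (b i)" by (elim disjE) simp_all
      then show "z \<in> ?R (a i) \<union> ?R (b i)" using R[of d] d by blast
    qed
    moreover have "x \<in> ?R (a i)" "y \<in> ?R (b i)" using R ab by simp_all
    ultimately have "x \<in> ?R (a i) \<inter> S" "y \<in> ?R (b i) \<inter> S" "S \<subseteq> ?R (a i) \<union> ?R (b i)"
      using S by simp_all
    moreover have "?R (a i) \<inter> ?R (b i) \<inter> S = {}" using disj by simp
    ultimately show False
      using connected_closedD[OF S(1), of "?R (a i)" "?R (b i)"] cl[of "a i"] cl[of "b i"]
      by (metis empty_iff)
  qed
  then show "connected_component_set (range g) x = {x}"
    using x by (auto simp: connected_component_refl_eq)
qed auto

subsection \<open>Dense Mycielski sets\<close>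

text \<open>The sequence formed by \<open>i\<close> ones, a zero, and then \<open>a\<close>. These
  prefixes are pairwise incompatible, so different \<open>i\<close> give disjoint cylinders.\<close>

definition branch :: "nat \<Rightarrow> (nat \<Rightarrow> bool) \<Rightarrow> nat \<Rightarrow> bool" where
  "branch i a = (\<lambda>j. if j < i then True else if j = i then False else a (j - Suc i))"

lemma branch_eq_iff: "branch i a = branch j b \<longleftrightarrow> i = j \<and> a = b"
proof
  assume e: "branch i a = branch j b"
  have "i = j"
  proof (rule ccontr)
    assume "i \<noteq> j"
    then show False using fun_cong[OF e, of i] fun_cong[OF e, of j]
      by (auto simp: branch_def split: if_splits)
  qed
  moreover have "a k = b k" for k
    using fun_cong[OF e, of "Suc i + k"] \<open>i = j\<close> by (auto simp: branch_def)
  ultimately show "i = j \<and> a = b" by blast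
qed auto

lemma cylinder_map_branch: "cylinder_map (branch i)"
  by (rule cylinder_map_coord) (auto simp: agree_def branch_def intro!: exI[of _ "Suc _"])

text \<open>Density is tested on rational intervals only, so that countably many pieces can achieve
  it.\<close>

lemma closure_eq_unit_interval:
  assumes "S \<subseteq> {0..1::real}"
    and "\<And>p q :: rat. 0 < p \<Longrightarrow> p < q \<Longrightarrow> q < 1 \<Longrightarrow> S \<inter> {of_rat p..of_rat q} \<noteq> {}"
  shows "closure S = {0..1}"
proof
  show "closure S \<subseteq> {0..1}" using assms(1) by (simp add: closure_minimal)
  show "{0..1} \<subseteq> closure S"
    unfolding closure_approachable subset_iff
  proof (intro allI impI)
    fix x e :: real assume x: "x \<in> {0..1}" and e: "e > 0"
    have "max 0 (x - e) < min 1 (x + e)" using x e by auto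
    then obtain q' :: real where q': "q' \<in> \<rat>" "max 0 (x - e) < q'" "q' < min 1 (x + e)"
      using Rats_dense_in_real by blast
    obtain p' :: real where p': "p' \<in> \<rat>" "max 0 (x - e) < p'" "p' < q'"
      using Rats_dense_in_real[OF q'(2)] by blast
    obtain p q :: rat where pq: "p' = of_rat p" "q' = of_rat q"
      using p' q' by (auto elim!: Rats_cases)
    have "0 < p" "p < q" "q < 1" using p' q' pq
      by (auto simp: of_rat_less)
    from assms(2)[OF this] obtain y where "y \<in> S" "y \<in> {p'..q'}" using pq by blast
    then show "\<exists>y\<in>S. dist y x < e" using p' q' by (intro bexI[of _ y]) (auto simp: dist_real_def)
  qed
qed

text \<open>Restricting the pieces to disjoint cylinders makes the code of a point determine both the
  piece and the point.\<close>

lemma dense_mycielski_union: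
  fixes g :: "nat \<Rightarrow> (nat \<Rightarrow> bool) \<Rightarrow> real"
  assumes cont: "\<And>i. cylinder_continuous (g i)" and inj: "\<And>i. inj (g i)"
    and unit: "\<And>i a. g i a \<in> {0..1}"
    and dense: "\<And>p q :: rat. 0 < p \<Longrightarrow> p < q \<Longrightarrow> q < 1
      \<Longrightarrow> \<exists>i. \<forall>a. g i a \<in> {of_rat p..of_rat q}"
  shows "\<exists>M c. M \<subseteq> {0..1} \<and> closure M = {0..1} \<and> mycielski_set M \<and> inj_on c M
    \<and> (\<forall>u\<in>M. \<exists>i. u = g i (c u)) \<and> (\<forall>i. \<exists>C. cantor_set C \<and> C \<subseteq> M \<and> C \<subseteq> range (g i))"
proof -
  let ?C = "\<lambda>i. range (\<lambda>a. g i (branch i a))"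
  define M where "M = (\<Union>i. ?C i)"
  define c where "c u = (SOME b. \<exists>i a. u = g i b \<and> b = branch i a)" for u
  have c: "\<exists>i a. u = g i (c u) \<and> c u = branch i a" if "u \<in> M" for u
  proof -
    have "\<exists>b i a. u = g i b \<and> b = branch i a" using that M_def by auto
    then show ?thesis unfolding c_def by (rule someI_ex)
  qed
  have cantor: "cantor_set (?C i)" for i
    by (rule cantor_set_range[OF cylinder_continuous_comp[OF cont cylinder_map_branch]])
      (auto intro!: injI dest!: injD[OF inj] simp: branch_eq_iff)
  have "inj_on c M"
  proof (rule inj_onI)
    fix u v assume "u \<in> M" "v \<in> M" "c u = c v"
    then show "u = v" using c[of u] c[of v] by (auto simp: branch_eq_iff)
  qed
  moreover have M01: "M \<subseteq> {0..1}" using unit by (auto simp: M_def)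
  moreover have "closure M = {0..1}"
  proof (rule closure_eq_unit_interval[OF M01])
    fix p q :: rat assume "0 < p" "p < q" "q < 1"
    from dense[OF this] obtain i where i: "\<forall>a. g i a \<in> {of_rat p..of_rat q}" by blast
    then have "g i (branch i a) \<in> M \<inter> {of_rat p..of_rat q}" for a by (auto simp: M_def)
    then show "M \<inter> {of_rat p..of_rat q} \<noteq> {}" by blast
  qed
  moreover have "mycielski_set M"
    unfolding mycielski_set_def
    by (rule exI[of _ "range ?C"]) (use cantor M_def in auto)
  moreover have "\<exists>C. cantor_set C \<and> C \<subseteq> M \<and> C \<subseteq> range (g i)" for i
    by (rule exI[of _ "?C i"]) (use cantor M_def in auto)
  ultimately show ?thesis using c by (intro exI[of _ M] exI[of _ c]) blast
qed

subsection \<open>Enumerating finite lookup tables\<close>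

text \<open>A table holds the number of bits to be read and an association list from prefixes to
  values. With countably many values there are only countably many tables.\<close>

type_synonym 'v table = "nat \<times> (bool list \<times> 'v) list"

definition lookup :: "'v table \<Rightarrow> (nat \<Rightarrow> bool) \<Rightarrow> 'v option" where
  "lookup c a = map_of (snd c) (map a [0..<fst c])"

text \<open>The second component of the decoded pair is discarded, so that every table recurs at
  infinitely many indices.\<close>

definition table :: "nat \<Rightarrow> 'v::countable table" where
  "table n = from_nat (fst (prod_decode n))"

lemma table_recurs: "\<exists>n\<ge>N. table n = c"
  by (rule exI[of _ "prod_encode (to_nat c, N)"]) (simp add: table_def le_prod_encode_2)

lemma lookup_agree:
  assumes "agree (fst c) a b"
  shows "lookup c a = lookup c b"
proof -
  have "map a [0..<fst c] = map b [0..<fst c]" using assms by (auto simp: agree_def)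
  then show ?thesis unfolding lookup_def by (rule arg_cong)
qed

lemma finite_range_lookup: "finite (range (lookup c))"
proof (rule finite_subset)
  show "range (lookup c) \<subseteq> insert None (Some ` snd ` set (snd c))"
  proof
    fix y assume "y \<in> range (lookup c)"
    then obtain a where a: "y = lookup c a" by auto
    show "y \<in> insert None (Some ` snd ` set (snd c))"
    proof (cases y)
      case (Some v)
      then have "(map a [0..<fst c], v) \<in> set (snd c)"
        using a map_of_SomeD unfolding lookup_def by metis
      then show ?thesis using Some by force
    qed simp
  qed
qed simp

text \<open>A table of prefix length 0 sees only the empty word and so treats all codes
  alike.\<close>

lemma table_const: "\<exists>n\<ge>N. \<forall>a. lookup (table n) a = Some v"
  using table_recurs[of N "(0, [([], v)])"] by (auto simp: lookup_def)

text \<open>Finitely many distinct codes are already told apart by a common prefix length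
  \<open>J\<close>, so a table on such prefixes can assign them arbitrary values.\<close>

lemma table_separates:
  fixes a :: "nat \<Rightarrow> nat \<Rightarrow> bool" and v :: "nat \<Rightarrow> 'v::countable"
  assumes inj: "inj_on a {..<p}"
  shows "\<exists>n\<ge>N. \<forall>i<p. lookup (table n) (a i) = Some (v i)"
proof -
  obtain d where d: "\<And>i j. i < p \<Longrightarrow> j < p \<Longrightarrow> i \<noteq> j \<Longrightarrow> a i (d i j) \<noteq> a j (d i j)"
    using inj unfolding inj_on_def fun_eq_iff by (metis lessThan_iff)
  define J where "J = Suc (Max ((\<lambda>(i, j). d i j) ` ({..<p} \<times> {..<p})))"
  have dJ: "d i j < J" if "i < p" "j < p" for i j
    unfolding J_def less_Suc_eq_le by (rule Max_ge) (use that in auto)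
  have injJ: "inj_on (\<lambda>i. map (a i) [0..<J]) {..<p}"
  proof (rule inj_onI, rule ccontr)
    fix i j assume ij: "i \<in> {..<p}" "j \<in> {..<p}" "map (a i) [0..<J] = map (a j) [0..<J]" "i \<noteq> j"
    then have "a i (d i j) = a j (d i j)" using dJ by auto
    then show False using d ij by auto
  qed
  let ?tab = "map (\<lambda>i. (map (a i) [0..<J], v i)) [0..<p]"
  obtain n where n: "n \<ge> N" "table n = (J, ?tab)" using table_recurs by blast
  have "lookup (table n) (a i) = Some (v i)" if "i < p" for i
    unfolding lookup_def n snd_conv fst_conv
  proof (rule map_of_is_SomeI)
    show "distinct (map fst ?tab)" using injJ by (simp add: distinct_map o_def atLeast0LessThan)
    show "(map (a i) [0..<J], v i) \<in> set ?tab" using that by auto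
  qed
  then show ?thesis using n by blast
qed

subsection \<open>Proximal and distal families of binary sequences\<close>

definition pad :: "bool list \<Rightarrow> nat \<Rightarrow> bool" where
  "pad l k \<longleftrightarrow> k < length l \<and> l ! k"

text \<open>New codes are finite words padded by \<open>False\<close>, which keeps the set of
  possible relabellings countable; a prefix missing from the table yields the zero sequence.\<close>

definition relabel :: "nat \<Rightarrow> (nat \<Rightarrow> bool) \<Rightarrow> nat \<Rightarrow> bool" where
  "relabel n a = pad (case lookup (table n) a of Some l \<Rightarrow> l | None \<Rightarrow> [])"

primrec block :: "nat \<Rightarrow> (nat \<Rightarrow> bool) \<Rightarrow> nat \<Rightarrow> bool" where
  "block 0 a k = a 0"
| "block (Suc n) a k = (if k < 2 ^ n then block n a k else block n (relabel n a) (k - 2 ^ n))"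

text \<open>The diagonal limit of the blocks: since \<open>k < 2 ^ k\<close>, the block of level
  \<open>k\<close> already determines position \<open>k\<close>.\<close>

definition weave :: "(nat \<Rightarrow> bool) \<Rightarrow> nat \<Rightarrow> bool" where
  "weave a k = block k a k"

lemma block_mono: "n \<le> m \<Longrightarrow> k < 2 ^ n \<Longrightarrow> block m a k = block n a k"
proof (induction m rule: dec_induct)
  case (step m)
  have "(2::nat) ^ n \<le> 2 ^ m" using step by simp
  then have "k < 2 ^ m" using step.prems by linarith
  then show ?case using step by simp
qed simp

lemma block_eq_weave: "k < 2 ^ n \<Longrightarrow> block n a k = weave a k"
  unfolding weave_def using block_mono[of n k k a] block_mono[of k n k a] less_exp[of k]
  by (cases "n \<le> k") auto

lemma weave_0: "weave a 0 = a 0"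
  by (simp add: weave_def)

text \<open>The segment of length \<open>2 ^ n\<close> starting at \<open>2 ^ n\<close> is the
  second half of the block of level \<open>n + 1\<close>. Through this identity, a choice of table
  dictates what the sequence does near time \<open>2 ^ n\<close>.\<close>

lemma weave_shift:
  assumes "k < 2 ^ n"
  shows "weave a (2 ^ n + k) = weave (relabel n a) k"
  using assms block_eq_weave[of "2 ^ n + k" "Suc n" a] block_eq_weave[of k n "relabel n a"] by simp

lemma relabel_const: "\<exists>n\<ge>N. \<forall>a. relabel n a = pad l"
  using table_const[of N l] unfolding relabel_def by (metis option.simps(5))

lemma relabel_separates:
  fixes a :: "nat \<Rightarrow> nat \<Rightarrow> bool"
  assumes "inj_on a {..<p}"
  shows "\<exists>n\<ge>N. \<forall>i<p. relabel n (a i) = pad (v i)"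
  using table_separates[OF assms, of N v] unfolding relabel_def by (metis option.simps(5))

text \<open>Each relabelling inspects only the prefix read by its table, so dependence on finitely
  many bits passes through the recursion.\<close>

lemma cylinder_map_weave: "cylinder_map weave"
proof (rule cylinder_map_coord)
  have "\<exists>N. \<forall>a b. agree N a b \<longrightarrow> block n a k = block n b k" for n k
  proof (induction n arbitrary: k)
    case 0
    then show ?case by (intro exI[of _ 1]) (auto simp: agree_def)
  next
    case (Suc n)
    obtain N where N: "\<forall>a b. agree N a b \<longrightarrow> block n a k = block n b k" using Suc by blast
    let ?N = "max N (fst (table n :: bool list table))"
    have "block (Suc n) a k = block (Suc n) b k" if "agree ?N a b" for a b
    proof -
      have "agree N a b" using that agree_mono max.cobounded1 by blast
      moreover have "agree (fst (table n :: bool list table)) a b"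
        using that agree_mono max.cobounded2 by blast
      then have "relabel n a = relabel n b" unfolding relabel_def by (simp add: lookup_agree)
      ultimately show ?thesis using N by simp
    qed
    then show ?case by blast
  qed
  then show "\<exists>N. \<forall>a b. agree N a b \<longrightarrow> weave a k = weave b k" for k
    unfolding weave_def by blast
qed

text \<open>A constant table gives all codes the same second half at its level.\<close>

lemma weave_proximal:
  "\<exists>n\<ge>N. \<forall>a b k. k < 2 ^ n \<longrightarrow> weave a (2 ^ n + k) = weave b (2 ^ n + k)"
  using relabel_const[of N "[]"] weave_shift by metis

lemma weave_differ:
  assumes "a \<noteq> b"
  shows "\<exists>k\<ge>N. weave a k \<noteq> weave b k"
proof -
  have "inj_on (\<lambda>i::nat. if i = 0 then a else b) {..<2}"
    using assms by (auto simp: inj_on_def)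
  \<comment> \<open>The two codes are relabelled to words with different first bits; that bit is
    then visible at position \<open>2 ^ n\<close>.\<close>
  from relabel_separates[OF this, of N "\<lambda>i. [i = 0]"]
  obtain n where "n \<ge> N"
    "\<forall>i<2::nat. relabel n (if i = 0 then a else b) = pad [i = 0]" by blast
  from this(1) this(2)[rule_format, of 0] this(2)[rule_format, of 1]
  have n: "n \<ge> N" "relabel n a = pad [True]" "relabel n b = pad [False]" by simp_all
  have "weave a (2 ^ n) \<noteq> weave b (2 ^ n)"
    using weave_shift[of 0 n a] weave_shift[of 0 n b] n by (simp add: weave_0 pad_def)
  moreover have "2 ^ n \<ge> N" using n less_exp[of n] by linarith
  ultimately show ?thesis by blast
qed

text \<open>The window length depends only on the number of sequences, because a suitable
  relabelling sends them to a fixed tuple.\<close>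

lemma weave_separated:
  fixes p :: nat
  shows "\<exists>L. \<forall>a. inj_on a {..<p} \<longrightarrow> (\<forall>N. \<exists>n\<ge>N. \<forall>i<p. \<forall>j<p. i \<noteq> j \<longrightarrow>
     (\<exists>k<L. weave (a i) (2 ^ n + k) \<noteq> weave (a j) (2 ^ n + k)))"
proof -
  \<comment> \<open>Runs of ones of different lengths serve as the fixed tuple; they stay distinct
    after padding.\<close>
  let ?l = "\<lambda>i. replicate i True"
  have ne: "pad (?l i) \<noteq> pad (?l j)" if "i < j" for i j
    using that by (auto simp: pad_def fun_eq_iff intro!: exI[of _ i])
  have "\<exists>k. weave (pad (?l i)) k \<noteq> weave (pad (?l j)) k" if "i \<noteq> j" for i j
    using weave_differ[of "pad (?l i)" "pad (?l j)"] ne that by (metis linorder_neqE_nat)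
  then obtain d where d: "\<And>i j. i \<noteq> j \<Longrightarrow> weave (pad (?l i)) (d i j) \<noteq> weave (pad (?l j)) (d i j)"
    by metis
  define L where "L = Suc (Max ((\<lambda>(i, j). d i j) ` ({..<p} \<times> {..<p})))"
  have dL: "d i j < L" if "i < p" "j < p" for i j
    unfolding L_def less_Suc_eq_le by (rule Max_ge) (use that in auto)
  show ?thesis
  proof (rule exI[of _ L], intro allI impI)
    fix a :: "nat \<Rightarrow> nat \<Rightarrow> bool" and N assume "inj_on a {..<p}"
    from relabel_separates[OF this, of "max N L" ?l]
    obtain n where n: "n \<ge> N" "n \<ge> L" "\<forall>i<p. relabel n (a i) = pad (?l i)" by auto
    have "\<exists>k<L. weave (a i) (2 ^ n + k) \<noteq> weave (a j) (2 ^ n + k)"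
      if ij: "i < p" "j < p" "i \<noteq> j" for i j
    proof (intro exI[of _ "d i j"] conjI)
      show "d i j < L" using dL ij by blast
      then have "d i j < 2 ^ n" using n less_exp[of n] by linarith
      then show "weave (a i) (2 ^ n + d i j) \<noteq> weave (a j) (2 ^ n + d i j)"
        using weave_shift n ij d by simp
    qed
    then show "\<exists>n\<ge>N. \<forall>i<p. \<forall>j<p. i \<noteq> j \<longrightarrow>
      (\<exists>k<L. weave (a i) (2 ^ n + k) \<noteq> weave (a j) (2 ^ n + k))" using n by blast
  qed
qed

text \<open>Removing the leading binary digit \<open>2 ^ e\<close> of \<open>q\<close> replaces the
  code by \<open>relabel (e + M) a\<close> and turns the aligned block into the one numbered
  \<open>q - 2 ^ e\<close>. Repetition ends at \<open>q = 0\<close>, where the block is a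
  prefix.\<close>

lemma weave_aligned: "\<exists>c. \<forall>i<2 ^ M. weave a (q * 2 ^ M + i) = weave c i"
proof (induction q arbitrary: a rule: less_induct)
  case (less q)
  show ?case
  proof (cases "q = 0")
    case False
    then obtain e where e: "2 ^ e \<le> q" "q < 2 ^ Suc e"
      using ex_power_ivl1[of 2 q] by auto
    define r where "r = q - 2 ^ e"
    have r: "r < q" "r < 2 ^ e" "q = 2 ^ e + r" using e by (auto simp: r_def)
    have "weave a (q * 2 ^ M + i) = weave (relabel (e + M) a) (r * 2 ^ M + i)" if "i < 2 ^ M" for i
    proof -
      have "r * 2 ^ M + i < (r + 1) * 2 ^ M" using that by simp
      also have "\<dots> \<le> 2 ^ e * 2 ^ M" using r by (intro mult_right_mono) auto
      finally have "r * 2 ^ M + i < 2 ^ (e + M)" by (simp add: power_add)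
      from weave_shift[OF this, of a] show ?thesis
        by (simp add: r(3) power_add algebra_simps)
    qed
    then show ?thesis using less.IH[OF r(1), of "relabel (e + M) a"] by metis
  qed auto
qed

text \<open>Some \<open>j\<close> bits of a code fix the first \<open>K\<close> symbols. For each
  word \<open>l\<close> of length \<open>j\<close> a constant table at level \<open>n l\<close>
  relabels every code to \<open>pad l\<close>; with \<open>M\<close> above these finitely many
  levels, each aligned block of length \<open>2 ^ M\<close> shows the wanted symbols at offset
  \<open>2 ^ n l\<close>.\<close>

lemma weave_recurs:
  "\<exists>L. \<forall>a b s. \<exists>k. s \<le> k \<and> k \<le> s + L \<and> (\<forall>i<K. weave a (k + i) = weave b i)"
proof -
  obtain j where j: "\<And>a b. agree j a b \<Longrightarrow> agree K (weave a) (weave b)"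
    using cylinder_map_weave unfolding cylinder_map_def by metis
  obtain n where n: "\<And>l. n l \<ge> K" "\<And>l a. relabel (n l) a = pad l"
    using relabel_const[of K] by metis
  let ?W = "{l :: bool list. length l = j}"
  define M where "M = Suc (Max (n ` ?W))"
  have fin: "finite ?W" using finite_lists_length_eq[of "UNIV :: bool set" j] by simp
  show ?thesis
  proof (rule exI[of _ "2 * 2 ^ M"], intro allI)
    fix a b :: "nat \<Rightarrow> bool" and s
    \<comment> \<open>\<open>?q\<close> numbers the first aligned block starting after
      \<open>s\<close>. Reaching it and then the offset inside it takes at most
      \<open>2 * 2 ^ M\<close> steps.\<close>
    let ?l = "map b [0..<j]" let ?q = "Suc (s div 2 ^ M)"
    have "n ?l \<le> Max (n ` ?W)" using fin by (intro Max_ge) auto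
    then have "n ?l < M" by (simp add: M_def)
    then have "Suc (n ?l) \<le> M" by simp
    then have "(2::nat) ^ Suc (n ?l) \<le> 2 ^ M" by (rule power_increasing) simp
    then have nM: "(2::nat) ^ n ?l + 2 ^ n ?l \<le> 2 ^ M" by simp
    obtain c where c: "\<forall>i<2 ^ M. weave a (?q * 2 ^ M + i) = weave c i"
      using weave_aligned by blast
    have ag: "agree K (weave (pad ?l)) (weave b)" by (rule j) (auto simp: agree_def pad_def)
    have K: "K < 2 ^ n ?l" using n(1)[of ?l] less_exp[of "n ?l"] by linarith
    have "weave a (?q * 2 ^ M + 2 ^ n ?l + i) = weave b i" if "i < K" for i
    proof -
      have "weave a (?q * 2 ^ M + (2 ^ n ?l + i)) = weave c (2 ^ n ?l + i)"
        using c nM K that by auto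
      also have "\<dots> = weave (pad ?l) i" using weave_shift[of i "n ?l" c] K that n(2) by simp
      also have "\<dots> = weave b i" using ag that by (auto simp: agree_def)
      finally show ?thesis by (simp add: add.assoc)
    qed
    moreover have "s \<le> ?q * 2 ^ M + 2 ^ n ?l" "?q * 2 ^ M + 2 ^ n ?l \<le> s + 2 * 2 ^ M"
    proof -
      have "s mod 2 ^ M < 2 ^ M" by simp
      moreover have "s = s div 2 ^ M * 2 ^ M + s mod 2 ^ M" by (rule div_mult_mod_eq[symmetric])
      moreover have "?q * 2 ^ M = s div 2 ^ M * 2 ^ M + 2 ^ M" by simp
      ultimately show "s \<le> ?q * 2 ^ M + 2 ^ n ?l" "?q * 2 ^ M + 2 ^ n ?l \<le> s + 2 * 2 ^ M"
        using nM by linarith+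
    qed
    ultimately show "\<exists>k. s \<le> k \<and> k \<le> s + 2 * 2 ^ M \<and> (\<forall>i<K. weave a (k + i) = weave b i)"
      by blast
  qed
qed

section \<open>Toeplitz sequences\<close>

text \<open>The bit is indexed by the 2-adic valuation of the position, counted from 1 so that the
  valuation is that of a nonzero number.\<close>

definition toeplitz :: "(nat \<Rightarrow> bool) \<Rightarrow> nat \<Rightarrow> bool" where
  "toeplitz a k = a (multiplicity 2 (Suc k))"

lemma cylinder_map_toeplitz: "cylinder_map toeplitz"
  by (rule cylinder_map_coord) (auto simp: agree_def toeplitz_def intro!: exI[of _ "Suc _"])

lemma toeplitz_distal:
  assumes "a \<noteq> b"
  shows "\<exists>L. \<forall>s. \<exists>k. s \<le> k \<and> k \<le> s + L \<and> toeplitz a k \<noteq> toeplitz b k"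
proof -
  obtain i where i: "a i \<noteq> b i" using assms unfolding fun_eq_iff by blast
  show ?thesis
  proof (rule exI[of _ "4 * 2 ^ i"], intro allI)
    fix s
    let ?q = "Suc (s div (2 * 2 ^ i))"
    \<comment> \<open>\<open>Suc k\<close> is an odd multiple of \<open>2 ^ i\<close>, so its
      valuation is exactly \<open>i\<close>. The odd factor puts \<open>k\<close> past
      \<open>s\<close>, within two periods of length \<open>2 * 2 ^ i\<close>.\<close>
    define k where "k = 2 ^ i * (2 * ?q + 1) - 1"
    have Sk: "Suc k = 2 ^ i * (2 * ?q + 1)" by (simp add: k_def)
    have "multiplicity 2 (Suc k) = i"
    proof (rule multiplicity_eqI)
      show "2 ^ i dvd Suc k" unfolding Sk by simp
      have "\<not> 2 dvd 2 * ?q + 1" by simp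
      then show "\<not> 2 ^ Suc i dvd Suc k" unfolding Sk power_Suc2
        by (metis dvd_times_left_cancel_iff power_not_zero zero_neq_numeral)
    qed
    then have "toeplitz a k \<noteq> toeplitz b k" using i by (simp add: toeplitz_def)
    moreover have "s \<le> k" "k \<le> s + 4 * 2 ^ i"
    proof -
      let ?d = "2 * 2 ^ i :: nat"
      have e: "Suc k = (s div ?d) * ?d + ?d + 2 ^ i" unfolding Sk by (simp add: algebra_simps)
      have "s = (s div ?d) * ?d + s mod ?d" by (rule div_mult_mod_eq[symmetric])
      moreover have "s mod ?d < ?d" by simp
      ultimately show "s \<le> k" "k \<le> s + 4 * 2 ^ i" using e by linarith+
    qed
    ultimately show "\<exists>k. s \<le> k \<and> k \<le> s + 4 * 2 ^ i \<and> toeplitz a k \<noteq> toeplitz b k" by blast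
  qed
qed

subsection \<open>Mixing interval maps\<close>

locale mixing_interval_map =
  fixes T :: "real \<Rightarrow> real"
  assumes cont: "continuous_on {0..1} T" and maps: "T ` {0..1} \<subseteq> {0..1}"
    and mixing: "topologically_mixing T"
begin

lemma iter_maps: "x \<in> {0..1} \<Longrightarrow> (T ^^ n) x \<in> {0..1}"
proof (induction n)
  case (Suc n)
  then show ?case using maps by (simp add: image_subset_iff)
qed simp

lemma cont_iter: "continuous_on {0..1} (T ^^ n)"
proof (induction n)
  case (Suc n)
  have "continuous_on {0..1} (T \<circ> (T ^^ n))"
    by (rule continuous_on_compose[OF Suc continuous_on_subset[OF cont]]) (use iter_maps in auto)
  then show ?case by simp
qed (simp add: continuous_on_id)

text \<open>The images of an interval are connected and eventually meet both components of the
  complement of \<open>{a..b}\<close>.\<close>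

lemma eventually_covers:
  assumes uv: "0 \<le> u" "u < v" "v \<le> 1" and ab: "0 < a" "b < 1"
  shows "\<forall>\<^sub>F n in sequentially. {a..b} \<subseteq> (T ^^ n) ` {u..v}"
proof (cases "a \<le> b")
  case True
  have op: "openin (top_of_set {0..1}) ({0..1} \<inter> W)" if "open W" for W :: "real set"
    using that by (simp add: openin_open_Int)
  have "\<exists>N. \<forall>n\<ge>N. (T ^^ n) ` ({0..1} \<inter> {u<..<v}) \<inter> ({0..1} \<inter> W) \<noteq> {}"
    if "open W" "{0..1} \<inter> W \<noteq> {}" for W
  proof -
    have "(u + v) / 2 \<in> {0..1} \<inter> {u<..<v}" using uv by auto
    then have ne: "{0..1} \<inter> {u<..<v} \<noteq> {}" by blast
    show ?thesis
      by (rule mixing[unfolded topologically_mixing_def, rule_format])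
        (intro conjI op that(1) ne that(2); simp)
  qed
  from this[of "{..<a}"] this[of "{b<..}"] ab
  obtain M N where M: "\<forall>n\<ge>M. (T ^^ n) ` ({0..1} \<inter> {u<..<v}) \<inter> ({0..1} \<inter> {..<a}) \<noteq> {}"
    and N: "\<forall>n\<ge>N. (T ^^ n) ` ({0..1} \<inter> {u<..<v}) \<inter> ({0..1} \<inter> {b<..}) \<noteq> {}"
    by (metis Int_iff atLeastAtMost_iff empty_iff greaterThan_iff lessThan_iff open_greaterThan
        open_lessThan order_refl zero_le_one)
  have "{a..b} \<subseteq> (T ^^ n) ` {u..v}" if n: "n \<ge> max M N" for n
  proof -
    have "connected ((T ^^ n) ` {u..v})"
      by (rule connected_continuous_image[OF continuous_on_subset[OF cont_iter]]) (use uv in auto)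
    moreover obtain x where "x \<in> (T ^^ n) ` {u..v}" "x < a" using M n by fastforce
    moreover obtain y where "y \<in> (T ^^ n) ` {u..v}" "b < y" using N n by fastforce
    ultimately have "{x..y} \<subseteq> (T ^^ n) ` {u..v}" using connected_contains_Icc by blast
    then show ?thesis using \<open>x < a\<close> \<open>b < y\<close> by auto
  qed
  then show ?thesis unfolding eventually_sequentially by blast
qed simp

text \<open>Cut the unit interval into \<open>K\<close> equal pieces shorter than
  \<open>e / 2\<close>. Any interval of length \<open>e\<close> contains a whole piece, and finitely
  many pieces have a common covering time.\<close>

lemma eventually_covers_uniform:
  assumes e: "0 < e" and ab: "0 < a" "b < 1"
  shows "\<exists>N. \<forall>n\<ge>N. \<forall>u v. 0 \<le> u \<longrightarrow> v \<le> 1 \<longrightarrow> u + e \<le> v \<longrightarrow> {a..b} \<subseteq> (T ^^ n) ` {u..v}"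
proof -
  obtain K :: nat where K: "2 / e < K" using reals_Archimedean2 by blast
  have K0: "real K > 0" using K e by (smt (verit) divide_pos_pos)
  have "\<forall>i\<in>{..<K}. \<forall>\<^sub>F n in sequentially. {a..b} \<subseteq> (T ^^ n) ` {real i / K..(real i + 1) / K}"
  proof
    fix i assume "i \<in> {..<K}"
    then have "real i + 1 \<le> K" by auto
    then show "\<forall>\<^sub>F n in sequentially. {a..b} \<subseteq> (T ^^ n) ` {real i / K..(real i + 1) / K}"
      using K0 ab by (intro eventually_covers) (auto simp: divide_simps)
  qed
  then have "\<forall>\<^sub>F n in sequentially. \<forall>i\<in>{..<K}. {a..b} \<subseteq> (T ^^ n) ` {real i / K..(real i + 1) / K}"
    by (rule eventually_ball_finite[rotated]) simp
  then obtain N where N: "\<And>n i. n \<ge> N \<Longrightarrow> i < K \<Longrightarrow> {a..b} \<subseteq> (T ^^ n) ` {real i / K..(real i + 1) / K}"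
    unfolding eventually_sequentially by (metis lessThan_iff)
  have "{a..b} \<subseteq> (T ^^ n) ` {u..v}" if n: "n \<ge> N" and uv: "0 \<le> u" "v \<le> 1" "u + e \<le> v" for n u v
  proof -
    define i where "i = nat \<lceil>u * K\<rceil>"
    have "0 \<le> u * K" using uv K0 by simp
    then have "real i = of_int \<lceil>u * K\<rceil>" by (simp add: i_def)
    then have i: "u * K \<le> i" "i < u * K + 1" by linarith+
    have "2 < e * K" using K e by (simp add: field_simps)
    moreover have "(u + e) * K \<le> v * K" using uv K0 by (intro mult_right_mono) auto
    ultimately have i1: "real i + 1 < v * K" using i by (simp add: distrib_right)
    moreover have "v * K \<le> 1 * real K" using uv K0 by (intro mult_right_mono) auto
    ultimately have iK: "i < K" by simp
    have "u \<le> i / K" "(real i + 1) / K \<le> v"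
      using i(1) i1 K0 by (simp_all add: pos_le_divide_eq pos_divide_le_eq)
    then have "{real i / K..(real i + 1) / K} \<subseteq> {u..v}" by simp
    then show ?thesis using N[OF n iK] by blast
  qed
  then show ?thesis by blast
qed

section \<open>Limits of nested intervals, and separation over time windows\<close>

text \<open>An interval of length at least \<open>e\<close> would cover \<open>{1/5..4/5}\<close>
  from some uniform time on; failing to do so at arbitrarily late times forces uniformly small
  length.\<close>

lemma nested_intervals_shrink:
  assumes V: "\<And>n x. closed_interval (V n x)"
    and small: "\<And>N. \<exists>n t. t \<ge> N \<and> (\<forall>x. \<not> {1/5..4/5} \<subseteq> (T ^^ t) ` V n x)"
    and e: "0 < e"
  shows "\<exists>n. \<forall>x. \<forall>y\<in>V n x. \<forall>z\<in>V n x. \<bar>y - z\<bar> < e"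
proof -
  obtain N where N: "\<forall>n\<ge>N. \<forall>u v. 0 \<le> u \<longrightarrow> v \<le> 1 \<longrightarrow> u + e \<le> v \<longrightarrow> {1/5..4/5} \<subseteq> (T ^^ n) ` {u..v}"
    using eventually_covers_uniform[OF e, of "1/5" "4/5"] by auto
  obtain n t where nt: "t \<ge> N" "\<forall>x. \<not> {1/5..4/5} \<subseteq> (T ^^ t) ` V n x" using small by blast
  have "\<bar>y - z\<bar> < e" if yz: "y \<in> V n x" "z \<in> V n x" for x y z
  proof -
    obtain u v where uv: "0 \<le> u" "v \<le> 1" "V n x = {u..v}"
      using V[of n x] unfolding closed_interval_def by blast
    have "\<not> u + e \<le> v" using N nt uv by metis
    then show ?thesis using yz uv by auto
  qed
  then show ?thesis by blast
qed

text \<open>Compactness gives a common point, shrinking gives its uniqueness and the uniform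
  continuity of \<open>g\<close>. Uniqueness later turns membership in all intervals into equality
  of points.\<close>

lemma nested_intervals_limit:
  fixes V :: "nat \<Rightarrow> (nat \<Rightarrow> bool) \<Rightarrow> real set"
  assumes V: "\<And>n a. closed_interval (V n a)"
    and nest: "\<And>n a. V (Suc n) a \<subseteq> V n a"
    and cyl: "\<And>n. \<exists>N. \<forall>a b. agree N a b \<longrightarrow> V n a = V n b"
    and small: "\<And>N. \<exists>n t. t \<ge> N \<and> (\<forall>a. \<not> {1/5..4/5} \<subseteq> (T ^^ t) ` V n a)"
  shows "\<exists>g. cylinder_continuous g \<and> (\<forall>a n. g a \<in> V n a) \<and> (\<forall>a x. (\<forall>n. x \<in> V n a) \<longrightarrow> x = g a)"
proof -
  have "\<Inter> (range (\<lambda>n. V n a)) \<noteq> {}" for a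
  proof (rule compact_nest)
    show "V n a \<subseteq> V m a" if "m \<le> n" for m n
      by (rule lift_Suc_antimono_le[of "\<lambda>n. V n a", OF nest that])
  qed (use closed_intervalD[OF V] in auto)
  then have "\<forall>a. \<exists>x. \<forall>n. x \<in> V n a" by fast
  then obtain g where g: "\<And>a n. g a \<in> V n a" by metis
  have "x = g a" if x: "\<forall>n. x \<in> V n a" for a x
  proof (rule ccontr)
    assume "x \<noteq> g a"
    then obtain n where "\<forall>y\<in>V n a. \<forall>z\<in>V n a. \<bar>y - z\<bar> < \<bar>x - g a\<bar>"
      using nested_intervals_shrink[OF V small, of "\<bar>x - g a\<bar>"] by auto
    then show False using x g by blast
  qed
  moreover have "cylinder_continuous g"
    unfolding cylinder_continuous_def
  proof (intro allI impI)
    fix e :: real assume "e > 0"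
    then obtain n where n: "\<forall>a. \<forall>y\<in>V n a. \<forall>z\<in>V n a. \<bar>y - z\<bar> < e"
      using nested_intervals_shrink[OF V small] by blast
    obtain N where "\<forall>a b. agree N a b \<longrightarrow> V n a = V n b" using cyl by blast
    then show "\<exists>N. \<forall>a b. agree N a b \<longrightarrow> \<bar>g a - g b\<bar> < e" using n g by metis
  qed
  ultimately show ?thesis using g by blast
qed

text \<open>The contrapositive of uniform equicontinuity of the iterates up to time
  \<open>L\<close>: separation somewhere in a bounded window ahead forces a fixed separation
  now.\<close>

lemma separation_pullback:
  assumes e: "0 < e"
  shows "\<exists>d>0. \<forall>x\<in>{0..1}. \<forall>y\<in>{0..1}. (\<exists>k\<le>L. e \<le> \<bar>(T ^^ k) x - (T ^^ k) y\<bar>) \<longrightarrow> d \<le> \<bar>x - y\<bar>"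
proof (induction L)
  case 0
  then show ?case using e by (intro exI[of _ e]) auto
next
  case (Suc L)
  then obtain d where d: "d > 0" "\<forall>x\<in>{0..1}. \<forall>y\<in>{0..1}.
    (\<exists>k\<le>L. e \<le> \<bar>(T ^^ k) x - (T ^^ k) y\<bar>) \<longrightarrow> d \<le> \<bar>x - y\<bar>" by blast
  have "uniformly_continuous_on {0..1} (T ^^ Suc L)"
    by (rule compact_uniformly_continuous[OF cont_iter]) simp
  then obtain d' where d': "d' > 0"
    "\<forall>x\<in>{0..1}. \<forall>y\<in>{0..1}. dist y x < d' \<longrightarrow> dist ((T ^^ Suc L) y) ((T ^^ Suc L) x) < e"
    unfolding uniformly_continuous_on_def using e by blast
  have "min d d' \<le> \<bar>x - y\<bar>" if xy: "x \<in> {0..1}" "y \<in> {0..1}"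
    and k: "k \<le> Suc L" "e \<le> \<bar>(T ^^ k) x - (T ^^ k) y\<bar>" for x y k
  proof (cases "k = Suc L")
    case True
    then have "\<not> dist x y < d'" using d'(2) xy k(2) unfolding dist_real_def by (meson not_le)
    then show ?thesis by (simp add: dist_real_def)
  next
    case False
    then show ?thesis using d(2) xy k by (meson le_SucE min.coboundedI1)
  qed
  then show ?case using d(1) d'(1) by (intro exI[of _ "min d d'"]) auto
qed

lemma eventually_iter_eq_mono:
  assumes "(T ^^ n) u = (T ^^ n) w" "n \<le> k"
  shows "(T ^^ k) u = (T ^^ k) w"
proof -
  have "(T ^^ (k - n + n)) u = (T ^^ (k - n + n)) w" unfolding funpow_add o_def using assms by simp
  then show ?thesis using assms by simp
qed

end

subsection \<open>An embedded full shift\<close>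

text \<open>A scheme for prescribing visits: \<open>F n\<close> is the iterate at the
  \<open>n\<close>-th chosen time and \<open>K n a\<close> the interval which the point with code
  \<open>a\<close> must then visit.\<close>

primrec refine :: "(nat \<Rightarrow> real \<Rightarrow> real) \<Rightarrow> (nat \<Rightarrow> 'a \<Rightarrow> real set) \<Rightarrow> real set \<Rightarrow> nat \<Rightarrow> 'a \<Rightarrow> real set"
where
  "refine F K V 0 a = V"
| "refine F K V (Suc n) a = subinterval_onto (F n) (refine F K V n a) (K n a)"

lemma refine:
  assumes F: "\<And>n. continuous_on {0..1} (F n)" and V: "closed_interval V"
    and K: "\<And>n a. closed_interval (K n a)" and K0: "\<And>a. K 0 a \<subseteq> F 0 ` V"
    and step: "\<And>n a S. S \<subseteq> {0..1} \<Longrightarrow> F n ` S = K n a \<Longrightarrow> K (Suc n) a \<subseteq> F (Suc n) ` S"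
  shows "closed_interval (refine F K V n a)" "refine F K V (Suc n) a \<subseteq> refine F K V n a"
    "F n ` refine F K V (Suc n) a = K n a"
proof -
  note sub = subinterval_onto[OF F _ K]
  \<comment> \<open>The induction must also carry that the current interval covers the next
    prescribed one, since this is what allows the next choice.\<close>
  have *: "closed_interval (refine F K V n a) \<and> K n a \<subseteq> F n ` refine F K V n a" for n
  proof (induction n)
    case 0
    then show ?case using V K0 by simp
  next
    case (Suc n)
    then have "closed_interval (refine F K V (Suc n) a)" "F n ` refine F K V (Suc n) a = K n a"
      using sub(1) sub(3) by simp_all
    then show ?case using step closed_intervalD(4) by blast
  qed
  show "closed_interval (refine F K V n a)" using * by blast
  show "refine F K V (Suc n) a \<subseteq> refine F K V n a" using * sub(2) by simp
  show "F n ` refine F K V (Suc n) a = K n a" using * sub(3) by simp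
qed

lemma refine_cylinder:
  assumes "\<And>n. \<exists>N. \<forall>a b. agree N a b \<longrightarrow> K n a = K n b"
  shows "\<exists>N. \<forall>a b. agree N a b \<longrightarrow> refine F K V n a = refine F K V n b"
proof (induction n)
  case (Suc n)
  obtain N M where N: "\<And>a b. agree N a b \<Longrightarrow> refine F K V n a = refine F K V n b"
    and M: "\<And>a b. agree M a b \<Longrightarrow> K n a = K n b"
    using Suc assms[of n] by blast
  have "refine F K V (Suc n) a = refine F K V (Suc n) b" if "agree (max N M) a b" for a b
    using N[of a b] M[of a b] agree_mono[OF that, of N] agree_mono[OF that, of M] by simp
  then show ?case by blast
qed simp

definition shift :: "nat \<Rightarrow> (nat \<Rightarrow> bool) \<Rightarrow> nat \<Rightarrow> bool" where
  "shift n a = (\<lambda>k. a (n + k))"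

lemma shift_simps [simp]: "shift 0 a = a" "shift n (shift k a) = shift (k + n) a"
  by (simp_all add: shift_def add.assoc)

lemma cylinder_map_shift: "cylinder_map (shift n)"
  by (rule cylinder_map_coord) (auto simp: agree_def shift_def intro!: exI[of _ "Suc _"])

text \<open>The gap of length 1/5 is the separation constant for differing bits. Both branches lie
  in \<open>{1/5..4/5}\<close> but neither contains it, which serves covering and shrinking
  respectively.\<close>

definition branch_interval :: "bool \<Rightarrow> real set" where
  "branch_interval b = (if b then {1/5..2/5} else {3/5..4/5})"

lemma branch_interval:
  "closed_interval (branch_interval b)" "branch_interval b \<subseteq> {1/5..4/5}"
  "\<not> {1/5..4/5} \<subseteq> branch_interval b"
proof -
  show "closed_interval (branch_interval b)"
    unfolding branch_interval_def closed_interval_def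
    by (cases b; force intro: exI[of _ "1/5"] exI[of _ "2/5"] exI[of _ "3/5"] exI[of _ "4/5"])
  have "1/2 \<in> {1/5..4/5::real}" "1/2 \<notin> branch_interval b" by (auto simp: branch_interval_def)
  then show "\<not> {1/5..4/5} \<subseteq> branch_interval b" by blast
qed (auto simp: branch_interval_def)

text \<open>The intervals are chosen along both the prefix order and the shift, which makes the
  resulting coding a conjugacy rather than only a semiconjugacy.\<close>

primrec itinerary_interval :: "(real \<Rightarrow> real) \<Rightarrow> nat \<Rightarrow> (nat \<Rightarrow> bool) \<Rightarrow> real set" where
  "itinerary_interval f 0 a = branch_interval (a 0)"
| "itinerary_interval f (Suc n) a =
     subinterval_onto f (itinerary_interval f n a) (itinerary_interval f n (shift 1 a))"

lemma itinerary_interval: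
  assumes f: "continuous_on {0..1} f" and horseshoe: "\<And>b. {1/5..4/5} \<subseteq> f ` branch_interval b"
  shows "closed_interval (itinerary_interval f n a)"
    "itinerary_interval f (Suc n) a \<subseteq> itinerary_interval f n a"
    "f ` itinerary_interval f (Suc n) a = itinerary_interval f n (shift 1 a)"
    "(f ^^ n) ` itinerary_interval f n a = branch_interval (a n)"
proof -
  let ?I = "itinerary_interval f"
  \<comment> \<open>All codes are treated at once, because the step for \<open>a\<close> uses the
    intervals of \<open>shift 1 a\<close>.\<close>
  have *: "\<forall>a. closed_interval (?I n a) \<and> ?I n (shift 1 a) \<subseteq> f ` ?I n a" for n
  proof (induction n)
    case 0
    have "branch_interval (shift 1 a 0) \<subseteq> f ` branch_interval (a 0)" for a
      using branch_interval(2) horseshoe by (rule order_trans)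
    then show ?case using branch_interval(1) by simp
  next
    case (Suc n)
    have "closed_interval (?I (Suc n) a)" "f ` ?I (Suc n) a = ?I n (shift 1 a)"
      "?I (Suc n) a \<subseteq> ?I n a" for a
      using subinterval_onto[OF f, of "?I n a" "?I n (shift 1 a)"] Suc by simp_all
    then show ?case by blast
  qed
  then show "closed_interval (?I n a)" by blast
  show "?I (Suc n) a \<subseteq> ?I n a" and img: "f ` ?I (Suc n) a = ?I n (shift 1 a)" for n a
    using subinterval_onto[OF f, of "?I n a" "?I n (shift 1 a)"] * by simp_all
  show "(f ^^ n) ` ?I n a = branch_interval (a n)"
  proof (induction n arbitrary: a)
    case (Suc n)
    have "(f ^^ Suc n) ` ?I (Suc n) a = (f ^^ n) ` (f ` ?I (Suc n) a)"
      by (simp only: funpow_Suc_right image_comp)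
    also have "\<dots> = (f ^^ n) ` ?I n (shift 1 a)" by (simp only: img)
    also have "\<dots> = branch_interval (a (Suc n))" by (simp only: Suc) (simp add: shift_def)
    finally show ?case .
  qed simp
qed

lemma itinerary_interval_cylinder:
  "\<exists>N. \<forall>a b. agree N a b \<longrightarrow> itinerary_interval f n a = itinerary_interval f n b"
proof (induction n)
  case 0
  then show ?case by (auto simp: agree_def intro!: exI[of _ 1])
next
  case (Suc n)
  then obtain N where N: "\<And>a b. agree N a b \<Longrightarrow> itinerary_interval f n a = itinerary_interval f n b"
    by blast
  have "itinerary_interval f (Suc n) a = itinerary_interval f (Suc n) b" if "agree (Suc N) a b" for a b
  proof -
    have "agree N a b" "agree N (shift 1 a) (shift 1 b)" using that by (auto simp: agree_def shift_def)
    then show ?thesis using N by simp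
  qed
  then show ?case by blast
qed

text \<open>\<open>h\<close> carries the shift to \<open>T ^^ m\<close> on its image, and
  \<open>h_section\<close> lifts this image into any nondegenerate interval. The lifting time is a
  multiple of \<open>m\<close>, so that it amounts to shifting a code by \<open>n\<close>
  places.\<close>

locale coded_interval_map = mixing_interval_map +
  fixes m :: nat and h :: "(nat \<Rightarrow> bool) \<Rightarrow> real"
  assumes m_pos: "0 < m" and h_cont: "cylinder_continuous h"
    and h_branch: "h a \<in> branch_interval (a 0)"
    and h_shift1: "(T ^^ m) (h a) = h (shift 1 a)"
    and h_section: "0 \<le> u \<Longrightarrow> u < v \<Longrightarrow> v \<le> 1 \<Longrightarrow>
      \<exists>n H. cylinder_continuous H \<and> (\<forall>a. H a \<in> {u..v} \<and> (T ^^ (m * n)) (H a) = h a)"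

context mixing_interval_map
begin

lemma coding_exists: "\<exists>m h. coded_interval_map T m h"
proof -
  have "\<forall>\<^sub>F n in sequentially. {1/5..4/5} \<subseteq> (T ^^ n) ` branch_interval b" for b
    unfolding branch_interval_def using eventually_covers[of "1/5" "2/5" "1/5" "4/5"]
      eventually_covers[of "3/5" "4/5" "1/5" "4/5"] by (cases b) auto
  then have "\<forall>\<^sub>F n in sequentially. n \<ge> 1 \<and> {1/5..4/5} \<subseteq> (T ^^ n) ` branch_interval True
      \<and> {1/5..4/5} \<subseteq> (T ^^ n) ` branch_interval False"
    by (intro eventually_conj eventually_ge_at_top)
  then obtain m where m: "m \<ge> 1" "{1/5..4/5} \<subseteq> (T ^^ m) ` branch_interval True"
      "{1/5..4/5} \<subseteq> (T ^^ m) ` branch_interval False"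
    unfolding eventually_sequentially by blast
  have hs: "{1/5..4/5} \<subseteq> (T ^^ m) ` branch_interval b" for b using m by (cases b) auto
  define I where "I = itinerary_interval (T ^^ m)"
  note I = itinerary_interval[OF cont_iter hs, folded I_def]
  have I_cyl: "\<exists>N. \<forall>a b. agree N a b \<longrightarrow> I n a = I n b" for n
    unfolding I_def by (rule itinerary_interval_cylinder)
  have Im: "(T ^^ (m * n)) ` I n a = branch_interval (a n)" for n a
    using I(4)[of n a] by (simp add: funpow_mult)
  \<comment> \<open>At time \<open>m * N\<close> each interval of level \<open>N\<close> becomes a
    single branch interval, which does not contain \<open>{1/5..4/5}\<close>.\<close>
  have "\<exists>n t. t \<ge> N \<and> (\<forall>a. \<not> {1/5..4/5} \<subseteq> (T ^^ t) ` I n a)" for N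
    using m Im branch_interval(3) by (intro exI[of _ N] exI[of _ "m * N"]) simp
  from nested_intervals_limit[OF I(1,2) I_cyl this]
  obtain h where h: "cylinder_continuous h" "\<And>a n. h a \<in> I n a"
    "\<And>a x. (\<And>n. x \<in> I n a) \<Longrightarrow> x = h a" by metis
  have "coded_interval_map T m h"
  proof
    show "0 < m" using m by simp
    show "cylinder_continuous h" by (rule h)
    show "h a \<in> branch_interval (a 0)" for a using h(2)[of a 0] by (simp add: I_def)
    \<comment> \<open>The image lies in every interval of the shifted code, and those meet in one
      point.\<close>
    show "(T ^^ m) (h a) = h (shift 1 a)" for a
      by (rule h(3)) (use I(3) h(2) in blast)
    fix u v :: real assume uv: "0 \<le> u" "u < v" "v \<le> 1"
    obtain n where n: "\<And>k. k \<ge> n \<Longrightarrow> {1/5..4/5} \<subseteq> (T ^^ k) ` {u..v}"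
      using eventually_covers[OF uv, of "1/5" "4/5"] unfolding eventually_sequentially by auto
    \<comment> \<open>The time stays fixed while the targets shrink: one iterate sends the nested
      intervals onto \<open>I 0 a\<close>, \<open>I 1 a\<close> and so on, hence their common point
      to \<open>h a\<close>.\<close>
    define F where "F = (\<lambda>_::nat. T ^^ (m * n))"
    have F: "continuous_on {0..1} (F k)" for k unfolding F_def by (rule cont_iter)
    have V: "closed_interval {u..v}" unfolding closed_interval_def using uv by auto
    have "I 0 a \<subseteq> {1/5..4/5}" for a using branch_interval(2) by (simp add: I_def)
    moreover have "n \<le> m * n" using m by simp
    ultimately have I0: "I 0 a \<subseteq> F 0 ` {u..v}" for a unfolding F_def using n by blast
    have step: "I (Suc k) a \<subseteq> F (Suc k) ` S" if "F k ` S = I k a" for k a S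
      using that I(2) by (simp add: F_def)
    note R = refine[where F = F and K = I, OF F V I(1) I0 step]
    let ?R = "refine F I {u..v}"
    have "\<exists>k t. t \<ge> N \<and> (\<forall>a. \<not> {1/5..4/5} \<subseteq> (T ^^ t) ` ?R k a)" for N
    proof (rule exI[of _ "Suc N"], rule exI[of _ "m * N + m * n"], intro conjI allI)
      show "N \<le> m * N + m * n" using m by (simp add: trans_le_add1)
      fix a
      have "(T ^^ (m * N + m * n)) ` ?R (Suc N) a = (T ^^ (m * N)) ` (F N ` ?R (Suc N) a)"
        unfolding F_def by (simp only: funpow_add image_comp)
      also have "\<dots> = branch_interval (a N)" by (simp only: R(3) Im)
      finally show "\<not> {1/5..4/5} \<subseteq> (T ^^ (m * N + m * n)) ` ?R (Suc N) a"
        using branch_interval(3) by simp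
    qed
    from nested_intervals_limit[OF R(1,2) refine_cylinder[OF I_cyl] this]
    obtain H where H: "cylinder_continuous H" "\<And>a k. H a \<in> ?R k a" by metis
    have "H a \<in> {u..v}" for a using H(2)[of a 0] by simp
    moreover have "(T ^^ (m * n)) (H a) = h a" for a
    proof (rule h(3))
      fix k
      have "F k (H a) \<in> F k ` ?R (Suc k) a" using H(2) by blast
      then have "F k (H a) \<in> I k a" by (simp only: R(3))
      then show "(T ^^ (m * n)) (H a) \<in> I k a" by (simp add: F_def)
    qed
    ultimately show "\<exists>n H. cylinder_continuous H \<and> (\<forall>a. H a \<in> {u..v} \<and> (T ^^ (m * n)) (H a) = h a)"
      using H(1) by blast
  qed
  then show ?thesis by blast
qed

end

context coded_interval_map
begin

lemma h_unit: "h a \<in> {0..1}"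
  using h_branch[of a] by (auto simp: branch_interval_def split: if_splits)

lemma h_shift: "(T ^^ (m * n)) (h a) = h (shift n a)"
proof (induction n)
  case (Suc n)
  have "(T ^^ (m * Suc n)) (h a) = (T ^^ m) ((T ^^ (m * n)) (h a))" by (simp add: funpow_add)
  then show ?case using Suc h_shift1 by simp
qed simp

lemma h_separated:
  assumes "a k \<noteq> b k"
  shows "1/5 \<le> \<bar>(T ^^ (m * k)) (h a) - (T ^^ (m * k)) (h b)\<bar>"
  using assms h_branch[of "shift k a"] h_branch[of "shift k b"] unfolding h_shift
  by (auto simp: branch_interval_def shift_def split: if_splits)

lemma h_inj:
  assumes "h a = h b"
  shows "a = b"
proof
  show "a k = b k" for k using h_separated[of a k b] assms by auto
qed

text \<open>Applying a section to the code shifted by \<open>n\<close> places puts the point into a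
  given interval and lets it meet the orbit of \<open>h (\<phi> a)\<close> at time
  \<open>m * n\<close>. Since different codes differ at arbitrarily late positions, the shift
  preserves injectivity.\<close>

lemma spread_codes:
  assumes cyl: "cylinder_map \<phi>" and differ: "\<And>a b N. a \<noteq> b \<Longrightarrow> \<exists>k\<ge>N. \<phi> a k \<noteq> \<phi> b k"
  shows "\<exists>M c. M \<subseteq> {0..1} \<and> closure M = {0..1} \<and> mycielski_set M \<and> inj_on c M
    \<and> (\<forall>u\<in>M. \<exists>K. \<forall>k\<ge>K. (T ^^ k) u = (T ^^ k) (h (\<phi> (c u))))
    \<and> (\<exists>C. cantor_set C \<and> C \<subseteq> M \<and> C \<subseteq> range (\<lambda>a. h (\<phi> a)))"
proof -
  let ?good = "\<lambda>G. cylinder_continuous G \<and> inj G \<and> (\<forall>a. G a \<in> {0..1})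
      \<and> (\<forall>a. \<exists>K. \<forall>k\<ge>K. (T ^^ k) (G a) = (T ^^ k) (h (\<phi> a)))"
  have "inj (\<lambda>a. h (\<phi> a))"
  proof (rule injI, rule ccontr)
    fix a b assume "h (\<phi> a) = h (\<phi> b)" "a \<noteq> b"
    then show False using h_inj differ[of a b 0] by metis
  qed
  then have h\<phi>: "?good (\<lambda>a. h (\<phi> a))"
    using cylinder_continuous_comp[OF h_cont cyl] h_unit by blast
  have "\<exists>G. ?good G \<and> (0 < p \<longrightarrow> p < q \<longrightarrow> q < 1 \<longrightarrow> (\<forall>a. G a \<in> {of_rat p..of_rat q}))" for p q :: rat
  proof (cases "0 < p \<and> p < q \<and> q < 1")
    case True
    then have pq: "0 \<le> real_of_rat p" "real_of_rat p < of_rat q" "real_of_rat q \<le> 1"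
      using of_rat_less[of q 1, where 'a = real] by (auto simp: of_rat_less)
    from h_section[OF this] obtain n H where H: "cylinder_continuous H"
      "\<And>a. H a \<in> {of_rat p..of_rat q}" "\<And>a. (T ^^ (m * n)) (H a) = h a" by blast
    let ?G = "\<lambda>a. H (shift n (\<phi> a))"
    have "inj ?G"
    proof (rule injI, rule ccontr)
      fix a b assume "?G a = ?G b" "a \<noteq> b"
      then have e: "shift n (\<phi> a) = shift n (\<phi> b)" using H(3) h_inj by metis
      obtain k where "k \<ge> n" "\<phi> a k \<noteq> \<phi> b k" using differ[OF \<open>a \<noteq> b\<close>] by blast
      then show False using fun_cong[OF e, of "k - n"] by (simp add: shift_def)
    qed
    moreover have "cylinder_continuous ?G"
      by (intro cylinder_continuous_comp[OF H(1)] cylinder_map_comp[OF cylinder_map_shift cyl])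
    moreover have "?G a \<in> {0..1}" for a 
      using H(2)[of "shift n (\<phi> a)"] pq by (meson atLeastAtMost_iff order_trans)
    moreover have "(T ^^ k) (?G a) = (T ^^ k) (h (\<phi> a))" if "k \<ge> m * n" for a k
      by (rule eventually_iter_eq_mono[OF _ that]) (simp add: H(3) h_shift)
    ultimately show ?thesis using H(2) by blast
  next
    case False
    then show ?thesis using h\<phi> by blast
  qed
  then obtain G where G: "\<And>p q. ?good (G p q)"
    "\<And>p q a. 0 < p \<Longrightarrow> p < q \<Longrightarrow> q < 1 \<Longrightarrow> G p q a \<in> {of_rat p..of_rat q}" by metis
  \<comment> \<open>Index 0 is reserved for the unspread piece, so that the union contains a Cantor
    set inside the image of the coding itself; the other indices enumerate pairs of
    rationals.\<close>
  define g where "g i = (case i of 0 \<Rightarrow> (\<lambda>a. h (\<phi> a))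
      | Suc j \<Rightarrow> G (fst (from_nat j :: rat \<times> rat)) (snd (from_nat j :: rat \<times> rat)))" for i
  have g: "?good (g i)" for i unfolding g_def using h\<phi> G(1) by (cases i) simp_all
  have dense: "\<exists>i. \<forall>a. g i a \<in> {of_rat p..of_rat q}" if "0 < p" "p < q" "q < 1" for p q :: rat
    using G(2)[OF that] by (intro exI[of _ "Suc (to_nat (p, q))"]) (simp add: g_def)
  have "\<exists>M c. M \<subseteq> {0..1} \<and> closure M = {0..1} \<and> mycielski_set M \<and> inj_on c M
    \<and> (\<forall>u\<in>M. \<exists>i. u = g i (c u)) \<and> (\<forall>i. \<exists>C. cantor_set C \<and> C \<subseteq> M \<and> C \<subseteq> range (g i))"
    by (rule dense_mycielski_union) (use g dense in blast)+
  then obtain M c where Mc: "M \<subseteq> {0..1}" "closure M = {0..1}" "mycielski_set M" "inj_on c M"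
    "\<forall>u\<in>M. \<exists>i. u = g i (c u)" "\<forall>i. \<exists>C. cantor_set C \<and> C \<subseteq> M \<and> C \<subseteq> range (g i)" by blast
  have "\<forall>u\<in>M. \<exists>K. \<forall>k\<ge>K. (T ^^ k) u = (T ^^ k) (h (\<phi> (c u)))" using Mc(5) g by metis
  moreover have "\<exists>C. cantor_set C \<and> C \<subseteq> M \<and> C \<subseteq> range (\<lambda>a. h (\<phi> a))"
    using Mc(6)[rule_format, of 0] by (simp add: g_def)
  ultimately show ?thesis using Mc(1-4) by blast
qed

end

subsection \<open>Li-Yorke tuples\<close>

text \<open>Separation by \<open>d\<close> infinitely often bounds the limsup below by
  \<open>d\<close> only, so the strict inequality calls for \<open>\<delta> < d\<close>.\<close>

lemma delta_li_yorkeI: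
  assumes n: "2 \<le> n" and \<delta>: "\<delta> < d"
    and prox: "\<And>e N. 0 < e \<Longrightarrow> \<exists>k\<ge>N. \<forall>i<n. \<forall>j<n. \<bar>(T ^^ k) (x i) - (T ^^ k) (x j)\<bar> < e"
    and sep: "\<And>N. \<exists>k\<ge>N. \<forall>i<n. \<forall>j<n. i \<noteq> j \<longrightarrow> d \<le> \<bar>(T ^^ k) (x i) - (T ^^ k) (x j)\<bar>"
  shows "delta_li_yorke T \<delta> n x"
proof -
  let ?r = "\<lambda>k i j. \<bar>(T ^^ k) (x i) - (T ^^ k) (x j)\<bar>"
  let ?A = "\<lambda>k. {?r k i j | i j. i < n \<and> j < n}"
  let ?B = "\<lambda>k. {?r k i j | i j. i < n \<and> j < n \<and> i \<noteq> j}"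
  have "?A k = (\<lambda>(i, j). ?r k i j) ` ({..<n} \<times> {..<n})" for k by auto
  then have finA: "finite (?A k)" for k by simp
  then have finB: "finite (?B k)" for k by (rule rev_finite_subset) auto
  have zero: "0 \<in> ?A k" for k using n by (auto intro!: exI[of _ 0])
  have neA: "?A k \<noteq> {}" for k using zero by blast
  have "?r k 0 1 \<in> ?B k" for k using n by force
  then have neB: "?B k \<noteq> {}" for k by blast
  let ?L = "liminf (\<lambda>k. ereal (Max (?A k)))"
  have L0: "0 \<le> ?L"
    by (rule Liminf_bounded) (use Max_ge[OF finA zero] in simp)
  have "\<not> 0 < ?L"
  proof
    assume "0 < ?L"
    then obtain e :: real where e: "0 < e" "ereal e < ?L"
      using ereal_dense2[of 0 ?L] by (auto simp: zero_ereal_def)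
    have "eventually (\<lambda>k. ereal e < ereal (Max (?A k))) sequentially"
      by (rule less_LiminfD[OF e(2)])
    then obtain N where N: "\<And>k. k \<ge> N \<Longrightarrow> e < Max (?A k)"
      unfolding eventually_sequentially by auto
    obtain k where k: "k \<ge> N" "\<forall>i<n. \<forall>j<n. ?r k i j < e" using prox[OF e(1)] by blast
    have "Max (?A k) < e" using Max_less_iff[OF finA neA] k(2) by blast
    then show False using N[OF k(1)] by simp
  qed
  then have "?L = 0" by (intro order.antisym L0 leI)
  moreover have "\<not> limsup (\<lambda>k. ereal (Min (?B k))) \<le> ereal \<delta>"
  proof
    assume "limsup (\<lambda>k. ereal (Min (?B k))) \<le> ereal \<delta>"
    then have "eventually (\<lambda>k. ereal (Min (?B k)) < ereal d) sequentially"
      using \<delta> unfolding Limsup_le_iff by (elim allE[of _ "ereal d"]) simp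
    then obtain N where N: "\<And>k. k \<ge> N \<Longrightarrow> Min (?B k) < d"
      unfolding eventually_sequentially by auto
    obtain k where k: "k \<ge> N" "\<forall>i<n. \<forall>j<n. i \<noteq> j \<longrightarrow> d \<le> ?r k i j" using sep by blast
    have "d \<le> Min (?B k)" using Min_ge_iff[OF finB neB] k(2) by blast
    then show False using N[OF k(1)] by simp
  qed
  ultimately show ?thesis unfolding delta_li_yorke_def by simp
qed

lemma delta_li_yorke_mono: "delta_li_yorke T \<delta> n x \<Longrightarrow> \<delta>' \<le> \<delta> \<Longrightarrow> delta_li_yorke T \<delta>' n x"
  unfolding delta_li_yorke_def by (meson ereal_less_eq(3) order.strict_trans1)

lemma not_li_yorke_pairI:
  assumes d: "0 < d" and dist: "\<And>k. k \<ge> N \<Longrightarrow> d \<le> \<bar>(T ^^ k) x - (T ^^ k) y\<bar>"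
  shows "\<not> li_yorke_pair T x y"
proof
  define z where "z = (\<lambda>i::nat. if i = 0 then x else y)"
  let ?A = "\<lambda>k. {\<bar>(T ^^ k) (z i) - (T ^^ k) (z j)\<bar> | i j. i < 2 \<and> j < 2}"
  assume "li_yorke_pair T x y"
  then have L: "liminf (\<lambda>k. ereal (Max (?A k))) = 0"
    unfolding li_yorke_pair_def delta_li_yorke_def z_def by blast
  have "?A k = (\<lambda>(i, j). \<bar>(T ^^ k) (z i) - (T ^^ k) (z j)\<bar>) ` ({..<2} \<times> {..<2})" for k by auto
  then have fin: "finite (?A k)" for k by simp
  have "ereal d \<le> ereal (Max (?A k))" if "k \<ge> N" for k
  proof -
    have "\<bar>(T ^^ k) (z 0) - (T ^^ k) (z 1)\<bar> \<in> ?A k" by fastforce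
    then have "\<bar>(T ^^ k) (z 0) - (T ^^ k) (z 1)\<bar> \<le> Max (?A k)" by (rule Max_ge[OF fin])
    then show ?thesis using dist[OF that] by (simp add: z_def)
  qed
  then have "eventually (\<lambda>k. ereal d \<le> ereal (Max (?A k))) sequentially"
    unfolding eventually_sequentially by blast
  then have "ereal d \<le> liminf (\<lambda>k. ereal (Max (?A k)))" by (rule Liminf_bounded)
  then show False using L d by (simp add: zero_ereal_def)
qed

text \<open>Here it is the limsup condition that fails, because all distances vanish.\<close>

lemma not_li_yorke_pair_refl: "\<not> li_yorke_pair T x x"
proof -
  have "{\<bar>(T ^^ k) (if i = 0 then x else x) - (T ^^ k) (if j = 0 then x else x)\<bar> | i j.
      i < 2 \<and> j < (2::nat) \<and> i \<noteq> j} = {0}" for k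
  proof -
    have "\<exists>i j. i < 2 \<and> j < (2::nat) \<and> i \<noteq> j"
      by (rule exI[of _ 0], rule exI[of _ 1]) simp
    then show ?thesis by auto
  qed
  then show ?thesis unfolding li_yorke_pair_def delta_li_yorke_def by (simp add: Limsup_const)
qed

text \<open>Converts a window for shift times into one for \<open>T\<close>, starting from the first
  multiple of \<open>m\<close> beyond \<open>s\<close>.\<close>

lemma multiple_window:
  fixes m :: nat
  assumes "0 < m" "Suc (s div m) \<le> k" "k \<le> Suc (s div m) + L"
  shows "s \<le> m * k" "m * k \<le> s + (m + m * L)"
proof -
  have s: "m * (s div m) + s mod m = s" "s mod m < m" using assms(1) by simp_all
  have "m * Suc (s div m) \<le> m * k" using assms(2) by (rule mult_le_mono2)
  then show "s \<le> m * k" using s unfolding mult_Suc_right by linarith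
  have "m * k \<le> m * (Suc (s div m) + L)" using assms(3) by (rule mult_le_mono2)
  then show "m * k \<le> s + (m + m * L)" using s unfolding distrib_left mult_Suc_right by linarith
qed

section \<open>A dense Mycielski set without Li-Yorke pairs\<close>

context coded_interval_map
begin

lemma distal_mycielski:
  "\<exists>M. M \<subseteq> {0..1} \<and> closure M = {0..1} \<and> mycielski_set M \<and> (\<forall>x\<in>M. \<forall>y\<in>M. \<not> li_yorke_pair T x y)"
proof -
  have "\<exists>k\<ge>N. toeplitz a k \<noteq> toeplitz b k" if "a \<noteq> b" for a b N
    using toeplitz_distal[OF that] by blast
  from spread_codes[OF cylinder_map_toeplitz this]
  obtain M c where M: "M \<subseteq> {0..1}" "closure M = {0..1}" "mycielski_set M" "inj_on c M"
    "\<forall>u\<in>M. \<exists>K. \<forall>k\<ge>K. (T ^^ k) u = (T ^^ k) (h (toeplitz (c u)))" by blast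
  have "\<not> li_yorke_pair T u v" if uv: "u \<in> M" "v \<in> M" for u v
  proof (cases "u = v")
    case False
    let ?a = "toeplitz (c u)" and ?b = "toeplitz (c v)"
    have "c u \<noteq> c v" using False M(4) uv by (meson inj_onD)
    from toeplitz_distal[OF this]
    obtain L where L: "\<And>s. \<exists>k. s \<le> k \<and> k \<le> s + L \<and> ?a k \<noteq> ?b k" by blast
    obtain d where d: "d > 0" "\<And>x y k. x \<in> {0..1} \<Longrightarrow> y \<in> {0..1} \<Longrightarrow> k \<le> m + m * L \<Longrightarrow>
        1/5 \<le> \<bar>(T ^^ k) x - (T ^^ k) y\<bar> \<Longrightarrow> d \<le> \<bar>x - y\<bar>"
      using separation_pullback[of "1/5" "m + m * L"] by (metis zero_less_divide_1_iff zero_less_numeral)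
    \<comment> \<open>Within a bounded time after \<open>t\<close> the Toeplitz codes differ at a
      multiple of \<open>m\<close>, where the points are 1/5 apart. Pulling this back gives a bound
      valid at every time, depending only on the pair.\<close>
    have far: "d \<le> \<bar>(T ^^ t) (h ?a) - (T ^^ t) (h ?b)\<bar>" for t
    proof -
      obtain k where k: "Suc (t div m) \<le> k" "k \<le> Suc (t div m) + L" "?a k \<noteq> ?b k" using L by blast
      note w = multiple_window[OF m_pos k(1,2)]
      have "1/5 \<le> \<bar>(T ^^ (m * k)) (h ?a) - (T ^^ (m * k)) (h ?b)\<bar>" by (rule h_separated[of ?a k ?b, OF k(3)])
      moreover have "(T ^^ (m * k)) x = (T ^^ (m * k - t)) ((T ^^ t) x)" for x
        using w(1) funpow_add[of "m * k - t" t T] by simp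
      moreover have "m * k - t \<le> m + m * L" using w(2) by simp
      ultimately show ?thesis using d(2)[of "(T ^^ t) (h ?a)" "(T ^^ t) (h ?b)"] iter_maps h_unit
        by metis
    qed
    obtain K K' where "\<forall>k\<ge>K. (T ^^ k) u = (T ^^ k) (h ?a)" "\<forall>k\<ge>K'. (T ^^ k) v = (T ^^ k) (h ?b)"
      using M(5) uv by blast
    then show ?thesis using far d(1) by (intro not_li_yorke_pairI[of d "max K K'"]) auto
  qed (simp add: not_li_yorke_pair_refl)
  then show ?thesis using M by blast
qed

section \<open>Proximality, separation and recurrence of woven points\<close>

abbreviation woven :: "(nat \<Rightarrow> bool) \<Rightarrow> real" where
  "woven a \<equiv> h (weave a)"

text \<open>One time works for all pairs of codes at once, as tuples require: after
  \<open>m * 2 ^ n\<close> steps all codes agree on their first \<open>K\<close> symbols.\<close>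

lemma woven_proximal:
  assumes "0 < e"
  shows "\<exists>k\<ge>N. \<forall>a b. \<bar>(T ^^ k) (woven a) - (T ^^ k) (woven b)\<bar> < e"
proof -
  obtain K where K: "\<And>a b. agree K a b \<Longrightarrow> \<bar>h a - h b\<bar> < e"
    using h_cont assms unfolding cylinder_continuous_def by blast
  obtain n where n: "n \<ge> max N K"
    "\<And>a b k. k < 2 ^ n \<Longrightarrow> weave a (2 ^ n + k) = weave b (2 ^ n + k)"
    using weave_proximal[of "max N K"] by blast
  have "agree K (shift (2 ^ n) (weave a)) (shift (2 ^ n) (weave b))" for a b
    unfolding agree_def shift_def
  proof (intro allI impI)
    fix i assume "i < K"
    then have "i < 2 ^ n" using n(1) less_exp[of n] by linarith
    then show "weave a (2 ^ n + i) = weave b (2 ^ n + i)" by (rule n(2))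
  qed
  then have "\<forall>a b. \<bar>(T ^^ (m * 2 ^ n)) (woven a) - (T ^^ (m * 2 ^ n)) (woven b)\<bar> < e"
    unfolding h_shift using K by blast
  moreover have "N \<le> m * 2 ^ n"
  proof -
    have "N \<le> 2 ^ n" using n(1) less_exp[of n] by linarith
    also have "\<dots> \<le> m * 2 ^ n" using m_pos by simp
    finally show ?thesis .
  qed
  ultimately show ?thesis by blast
qed

text \<open>Different pairs of the tuple may differ at different positions of the window. Pulling
  each separation back to the start of the window makes them hold at one common time, with a bound
  depending only on \<open>p\<close>.\<close>

lemma woven_separated:
  fixes p :: nat
  shows "\<exists>d>0. \<forall>a. inj_on a {..<p} \<longrightarrow> (\<forall>N. \<exists>k\<ge>N. \<forall>i<p. \<forall>j<p. i \<noteq> j \<longrightarrow>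
    d \<le> \<bar>(T ^^ k) (woven (a i)) - (T ^^ k) (woven (a j))\<bar>)"
proof -
  obtain L where L: "\<And>a N. inj_on a {..<p} \<Longrightarrow> \<exists>n\<ge>N. \<forall>i<p. \<forall>j<p. i \<noteq> j \<longrightarrow>
     (\<exists>k<L. weave (a i) (2 ^ n + k) \<noteq> weave (a j) (2 ^ n + k))"
    using weave_separated[of p] by blast
  obtain d where d: "d > 0" "\<And>x y k. x \<in> {0..1} \<Longrightarrow> y \<in> {0..1} \<Longrightarrow> k \<le> m * L \<Longrightarrow>
      1/5 \<le> \<bar>(T ^^ k) x - (T ^^ k) y\<bar> \<Longrightarrow> d \<le> \<bar>x - y\<bar>"
    using separation_pullback[of "1/5" "m * L"] by (metis zero_less_divide_1_iff zero_less_numeral)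
  have "\<exists>k\<ge>N. \<forall>i<p. \<forall>j<p. i \<noteq> j \<longrightarrow> d \<le> \<bar>(T ^^ k) (woven (a i)) - (T ^^ k) (woven (a j))\<bar>"
    if a: "inj_on a {..<p}" for a :: "nat \<Rightarrow> nat \<Rightarrow> bool" and N
  proof -
    from L[OF a, of N] obtain n where n: "n \<ge> N" "\<forall>i<p. \<forall>j<p. i \<noteq> j \<longrightarrow>
     (\<exists>k<L. weave (a i) (2 ^ n + k) \<noteq> weave (a j) (2 ^ n + k))" by blast
    let ?t = "m * 2 ^ n"
    have "d \<le> \<bar>(T ^^ ?t) (woven (a i)) - (T ^^ ?t) (woven (a j))\<bar>"
      if ij: "i < p" "j < p" "i \<noteq> j" for i j
    proof -
      obtain k where k: "k < L" "weave (a i) (2 ^ n + k) \<noteq> weave (a j) (2 ^ n + k)"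
        using n(2) ij by blast
      have "(T ^^ (m * (2 ^ n + k))) x = (T ^^ (m * k)) ((T ^^ ?t) x)" for x
        by (simp add: distrib_left add.commute[of "m * 2 ^ n"] funpow_add)
      with h_separated[of "weave (a i)" "2 ^ n + k" "weave (a j)", OF k(2)]
      have "1/5 \<le> \<bar>(T ^^ (m * k)) ((T ^^ ?t) (woven (a i))) - (T ^^ (m * k)) ((T ^^ ?t) (woven (a j)))\<bar>"
        by simp
      then show ?thesis using d(2) iter_maps h_unit k(1) by (meson less_imp_le_nat mult_le_mono2)
    qed
    moreover have "N \<le> ?t"
    proof -
      have "N \<le> 2 ^ n" using n(1) less_exp[of n] by linarith
      also have "\<dots> \<le> ?t" using m_pos by simp
      finally show ?thesis .
    qed
    ultimately show ?thesis by blast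
  qed
  then show ?thesis using d(1) by blast
qed

lemma woven_recurs:
  assumes "0 < e"
  shows "\<exists>L. \<forall>a b s. \<exists>k. s \<le> k \<and> k \<le> s + L \<and> \<bar>(T ^^ k) (woven a) - woven b\<bar> < e"
proof -
  obtain K where K: "\<And>a b. agree K a b \<Longrightarrow> \<bar>h a - h b\<bar> < e"
    using h_cont assms unfolding cylinder_continuous_def by blast
  obtain L where L: "\<And>a b s. \<exists>k. s \<le> k \<and> k \<le> s + L \<and> (\<forall>i<K. weave a (k + i) = weave b i)"
    using weave_recurs[of K] by blast
  have "\<exists>k. s \<le> k \<and> k \<le> s + (m + m * L) \<and> \<bar>(T ^^ k) (woven a) - woven b\<bar> < e" for a b s
  proof -
    obtain k where k: "Suc (s div m) \<le> k" "k \<le> Suc (s div m) + L"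
      "\<forall>i<K. weave a (k + i) = weave b i" using L by blast
    have "\<bar>(T ^^ (m * k)) (woven a) - woven b\<bar> < e"
      unfolding h_shift by (rule K) (use k(3) in \<open>simp add: agree_def shift_def\<close>)
    then show ?thesis using multiple_window[OF m_pos k(1,2)] by blast
  qed
  then show ?thesis by blast
qed

text \<open>The weaves differ at some position \<open>i \<ge> k\<close>, so the orbits are still
  apart at time \<open>m * i\<close>, which is not before \<open>k\<close>. This will supply
  distinct nearby points of the minimal set.\<close>

lemma woven_iter_inj:
  assumes "a \<noteq> b"
  shows "(T ^^ k) (woven a) \<noteq> (T ^^ k) (woven b)"
proof
  assume e: "(T ^^ k) (woven a) = (T ^^ k) (woven b)"
  obtain i where i: "i \<ge> k" "weave a i \<noteq> weave b i" using weave_differ[OF assms] by blast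
  have "k \<le> m * i" using i(1) m_pos by (metis dual_order.trans nat_mult_le_cancel1 mult.commute mult_le_mono2 mult.right_neutral Suc_leI One_nat_def)
  then have "(T ^^ (m * i)) (woven a) = (T ^^ (m * i)) (woven b)"
    using eventually_iter_eq_mono[OF e] by blast
  then show False using h_separated[of "weave a" i "weave b"] i(2) by simp
qed

end

context coded_interval_map
begin

subsection \<open>The minimal set\<close>

lemma iter_close:
  assumes "0 < e"
  shows "\<exists>d>0. \<forall>x\<in>{0..1}. \<forall>y\<in>{0..1}. \<bar>x - y\<bar> < d \<longrightarrow> (\<forall>k\<le>L. \<bar>(T ^^ k) x - (T ^^ k) y\<bar> < e)"
  using separation_pullback[OF assms, of L] by (meson not_le)

text \<open>The orbit closure of one fixed woven point; recurrence shows that it contains all woven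
  points.\<close>

definition core :: "real set" where
  "core = closure (range (\<lambda>k. (T ^^ k) (woven (pad []))))"

lemma closed_core: "closed core"
  by (simp add: core_def)

lemma core_approx:
  assumes "w \<in> core" "0 < e"
  shows "\<exists>k. \<bar>(T ^^ k) (woven (pad [])) - w\<bar> < e"
  using assms unfolding core_def closure_approachable dist_real_def by blast

lemma core_unit: "core \<subseteq> {0..1}"
  unfolding core_def by (rule closure_minimal) (use iter_maps h_unit in auto)

lemma core_invariant:
  assumes "w \<in> core"
  shows "(T ^^ k) w \<in> core"
proof (induction k)
  case (Suc k)
  have "T ` core \<subseteq> core"
    unfolding core_def
  proof (rule image_closure_subset)
    show "continuous_on (closure (range (\<lambda>k. (T ^^ k) (woven (pad []))))) T"
      using continuous_on_subset[OF cont core_unit] by (simp add: core_def)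
    show "T ` range (\<lambda>k. (T ^^ k) (woven (pad [])))
        \<subseteq> closure (range (\<lambda>k. (T ^^ k) (woven (pad []))))"
    proof (intro image_subsetI)
      fix y assume "y \<in> range (\<lambda>k. (T ^^ k) (woven (pad [])))"
      then obtain k where "y = (T ^^ k) (woven (pad []))" by blast
      then have "T y = (T ^^ Suc k) (woven (pad []))" by simp
      then show "T y \<in> closure (range (\<lambda>k. (T ^^ k) (woven (pad []))))"
        by (intro subsetD[OF closure_subset] range_eqI)
    qed
  qed simp
  then show ?case using Suc by auto
qed (use assms in simp)

lemma woven_in_core: "woven a \<in> core"
  unfolding core_def closure_approachable dist_real_def
proof (intro allI impI)
  fix e :: real assume "0 < e"
  from woven_recurs[OF this] obtain k where "\<bar>(T ^^ k) (woven (pad [])) - woven a\<bar> < e"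
    by meson
  then show "\<exists>y\<in>range (\<lambda>k. (T ^^ k) (woven (pad []))). \<bar>y - woven a\<bar> < e"
    by (intro bexI[of _ "(T ^^ k) (woven (pad []))"]) simp_all
qed

text \<open>An iterate \<open>T ^^ j\<close> of the base point approximates \<open>w\<close>, and
  the orbit of \<open>woven a\<close> comes arbitrarily late and close to the base point; applying
  \<open>T ^^ j\<close> there brings it near \<open>w\<close>.\<close>

lemma woven_returns:
  assumes w: "w \<in> core" and e: "0 < e"
  shows "\<exists>k\<ge>N. \<bar>(T ^^ k) (woven a) - w\<bar> < e"
proof -
  obtain j where j: "\<bar>(T ^^ j) (woven (pad [])) - w\<bar> < e / 2"
    using core_approx[OF w, of "e / 2"] e by auto
  have "0 < e / 2" using e by simp
  from iter_close[OF this, of j] obtain d where d: "d > 0"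
    "\<And>x y. x \<in> {0..1} \<Longrightarrow> y \<in> {0..1} \<Longrightarrow> \<bar>x - y\<bar> < d \<Longrightarrow> \<bar>(T ^^ j) x - (T ^^ j) y\<bar> < e / 2" by blast
  obtain k where k: "k \<ge> N" "\<bar>(T ^^ k) (woven a) - woven (pad [])\<bar> < d"
    using woven_recurs[OF d(1)] by blast
  have "\<bar>(T ^^ j) ((T ^^ k) (woven a)) - (T ^^ j) (woven (pad []))\<bar> < e / 2"
    by (rule d(2)[OF iter_maps[OF h_unit] h_unit k(2)])
  then have "\<bar>(T ^^ (j + k)) (woven a) - w\<bar> < e" unfolding funpow_add o_def using j by linarith
  then show ?thesis using k(1) by (intro exI[of _ "j + k"]) simp
qed

text \<open>A uniformly recurrent point has a minimal orbit closure: a point \<open>w\<close> of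
  \<open>B\<close> is shadowed by some \<open>T ^^ s\<close> of the base point, which returns to
  itself within \<open>L\<close> further steps, with \<open>L\<close> fixed before \<open>s\<close>.
  So \<open>w\<close> comes near the base point while staying in \<open>B\<close>.\<close>

lemma minimal_core: "minimal_set T core"
  unfolding minimal_set_def
proof (intro conjI allI impI)
  show "core \<noteq> {}" using woven_in_core by blast
  show "closed core" by (rule closed_core)
  show "invariant_set T core" unfolding invariant_set_def using core_invariant[of _ 1] by auto
  fix B assume B: "B \<subseteq> core \<and> B \<noteq> {} \<and> closed B \<and> invariant_set T B"
  then obtain w where w: "w \<in> B" by blast
  have inv: "(T ^^ k) y \<in> B" if "y \<in> B" for k y
    using that B unfolding invariant_set_def by (induction k) auto
  let ?z = "woven (pad [])"
  have "?z \<in> closure B"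
    unfolding closure_approachable dist_real_def
  proof (intro allI impI)
    fix e :: real assume "0 < e"
    then have e: "0 < e / 2" by simp
    obtain L where L: "\<And>s. \<exists>k. s \<le> k \<and> k \<le> s + L \<and> \<bar>(T ^^ k) ?z - ?z\<bar> < e / 2"
      using woven_recurs[OF e] by blast
    from iter_close[OF e, of L] obtain d where d: "d > 0" "\<And>x y k. x \<in> {0..1} \<Longrightarrow> y \<in> {0..1}
        \<Longrightarrow> \<bar>x - y\<bar> < d \<Longrightarrow> k \<le> L \<Longrightarrow> \<bar>(T ^^ k) x - (T ^^ k) y\<bar> < e / 2" by blast
    have wc: "w \<in> core" "w \<in> {0..1}" using w B core_unit by auto
    obtain s where s: "\<bar>(T ^^ s) ?z - w\<bar> < d" using core_approx[OF wc(1) d(1)] by blast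
    obtain k where k: "s \<le> k" "k \<le> s + L" "\<bar>(T ^^ k) ?z - ?z\<bar> < e / 2" using L by blast
    have "\<bar>(T ^^ (k - s)) ((T ^^ s) ?z) - (T ^^ (k - s)) w\<bar> < e / 2"
      using d(2)[OF iter_maps[OF h_unit] wc(2) s] k by simp
    moreover have "(T ^^ (k - s)) ((T ^^ s) ?z) = (T ^^ k) ?z"
      using funpow_add[of "k - s" s T] k(1) by simp
    ultimately have "\<bar>(T ^^ (k - s)) w - ?z\<bar> < e" using k(3) by linarith
    then show "\<exists>y\<in>B. \<bar>y - ?z\<bar> < e" using inv w by blast
  qed
  then have "?z \<in> B" using B by simp
  then have "range (\<lambda>k. (T ^^ k) ?z) \<subseteq> B" using inv by blast
  then have "core \<subseteq> B" unfolding core_def using B closure_minimal by blast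
  then show "B = core" using B by blast
qed

text \<open>The iterates of an interval reach every point of the open unit interval, so the closed
  invariant core would be all of \<open>{0..1}\<close>. A fixed point of \<open>T\<close> would then
  contradict minimality.\<close>

lemma core_no_interval:
  assumes "u < v"
  shows "\<not> {u..v} \<subseteq> core"
proof
  assume sub: "{u..v} \<subseteq> core"
  then have "{u..v} \<subseteq> {0..1}" using core_unit by blast
  then have uv: "0 \<le> u" "v \<le> 1" using assms by auto
  have "x \<in> core" if "x \<in> {0<..<1}" for x
  proof -
    have "\<forall>\<^sub>F n in sequentially. {x..x} \<subseteq> (T ^^ n) ` {u..v}"
      by (rule eventually_covers) (use uv assms that in auto)
    then obtain n where "{x..x} \<subseteq> (T ^^ n) ` {u..v}" unfolding eventually_sequentially by blast
    then show ?thesis using sub core_invariant by auto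
  qed
  then have "closure {0<..<1} \<subseteq> core" using closed_core by (intro closure_minimal) auto
  then have full: "core = {0..1}" using core_unit by simp
  obtain x where x: "x \<in> {0..1}" "T x = x"
    using brouwer[of "{0..1::real}" T] cont maps by auto
  then have "{x} = core"
    using minimal_core full unfolding minimal_set_def invariant_set_def by auto
  then have "(0::real) = 1" using full by (metis atLeastAtMost_singleton_iff atLeastAtMost_iff order_refl singletonD zero_le_one)
  then show False by simp
qed

lemma cantor_core: "cantor_set core"
  unfolding cantor_set_def
proof (intro conjI ballI)
  show "core \<noteq> {}" using woven_in_core by blast
  show "compact core"
    using closed_core core_unit by (meson bounded_closed_interval bounded_subset compact_eq_bounded_closed)
next
  fix w assume w: "w \<in> core"
  let ?z = "\<lambda>k a. (T ^^ k) (woven a)"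
  show "w islimpt core"
    unfolding islimpt_approachable dist_real_def
  proof (intro allI impI)
    fix e :: real assume "0 < e"
    then have e: "0 < e / 2" by simp
    obtain k where k: "\<bar>?z k (pad []) - w\<bar> < e / 2" using core_approx[OF w e] by blast
    from iter_close[OF e, of k] obtain d where d: "d > 0"
      "\<And>x y. x \<in> {0..1} \<Longrightarrow> y \<in> {0..1} \<Longrightarrow> \<bar>x - y\<bar> < d \<Longrightarrow> \<bar>(T ^^ k) x - (T ^^ k) y\<bar> < e / 2" by blast
    obtain N where N: "\<And>a b. agree N a b \<Longrightarrow> \<bar>woven a - woven b\<bar> < d"
      using cylinder_continuous_comp[OF h_cont cylinder_map_weave] d(1)
      unfolding cylinder_continuous_def by blast
    \<comment> \<open>Two codes agreeing on \<open>N\<close> bits have distinct \<open>k\<close>-th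
      iterates, both within \<open>e\<close> of \<open>w\<close>; at least one of them differs from
      \<open>w\<close>.\<close>
    let ?b = "(pad [])(N := True)"
    have "?b N \<noteq> pad [] N" by (simp add: pad_def)
    then have ne: "?b \<noteq> pad []" by metis
    have "\<bar>?z k ?b - ?z k (pad [])\<bar> < e / 2"
      by (rule d(2)[OF h_unit h_unit N]) (simp add: agree_def)
    then have "\<bar>?z k ?b - w\<bar> < e" using k by linarith
    moreover have "\<bar>?z k (pad []) - w\<bar> < e" using k e by linarith
    moreover have "?z k ?b \<noteq> w \<or> ?z k (pad []) \<noteq> w" using woven_iter_inj[OF ne, of k] by auto
    moreover have "?z k a \<in> core" for a by (rule core_invariant[OF woven_in_core])
    ultimately show "\<exists>x'\<in>core. x' \<noteq> w \<and> \<bar>x' - w\<bar> < e" by blast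
  qed
  have "y = w" if y: "y \<in> connected_component_set core w" for y
  proof (rule ccontr)
    assume "y \<noteq> w"
    obtain S where S: "connected S" "S \<subseteq> core" "w \<in> S" "y \<in> S"
      using y unfolding connected_component_def by auto
    then have "{min w y..max w y} \<subseteq> core"
      using connected_contains_Icc[of S "min w y" "max w y"] by (metis dual_order.trans max_def min_def)
    then show False using core_no_interval[of "min w y" "max w y"] \<open>y \<noteq> w\<close> by linarith
  qed
  then show "connected_component_set core w = {w}"
    using w by (auto simp: connected_component_refl_eq)
qed

lemma omega_limit_eq_core:
  assumes x: "\<And>k. k \<ge> K \<Longrightarrow> (T ^^ k) x = (T ^^ k) (woven a)"
  shows "omega_limit T x = core"
proof
  show "omega_limit T x \<subseteq> core"
  proof
    fix y assume "y \<in> omega_limit T x"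
    then obtain r where r: "strict_mono r" "(\<lambda>k. (T ^^ r k) x) \<longlonglongrightarrow> y"
      unfolding omega_limit_def by blast
    show "y \<in> core"
    proof (rule Lim_in_closed_set[OF closed_core _ _ r(2)])
      have "(T ^^ r k) x \<in> core" if "k \<ge> K" for k
      proof -
        have "r k \<ge> K" using seq_suble[OF r(1), of k] that by linarith
        then show ?thesis using x core_invariant[OF woven_in_core] by simp
      qed
      then show "\<forall>\<^sub>F k in sequentially. (T ^^ r k) x \<in> core"
        unfolding eventually_sequentially by blast
    qed simp
  qed
  show "core \<subseteq> omega_limit T x"
  proof
    fix w assume w: "w \<in> core"
    have near: "\<exists>k\<ge>N. \<bar>(T ^^ k) x - w\<bar> < inverse (real (Suc n))" for N n
    proof -
      obtain k where "k \<ge> max N K" "\<bar>(T ^^ k) (woven a) - w\<bar> < inverse (real (Suc n))"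
        using woven_returns[OF w, of "inverse (real (Suc n))" "max N K" a] by auto
      then show ?thesis using x by auto
    qed
    have "\<exists>r. \<forall>n. \<bar>(T ^^ r n) x - w\<bar> < inverse (real (Suc n)) \<and> r n < r (Suc n)"
    proof (rule dependent_nat_choice)
      show "\<exists>k. \<bar>(T ^^ k) x - w\<bar> < inverse (real (Suc 0))" using near[of 0 0] by blast
      show "\<exists>l. \<bar>(T ^^ l) x - w\<bar> < inverse (real (Suc (Suc n))) \<and> k < l" for k n
        using near[of "Suc k" "Suc n"] by (meson Suc_le_lessD)
    qed
    then obtain r where r: "\<And>n. \<bar>(T ^^ r n) x - w\<bar> < inverse (real (Suc n))" "\<And>n. r n < r (Suc n)"
      by blast
    have "(\<lambda>n. (T ^^ r n) x - w) \<longlonglongrightarrow> 0"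
      by (rule Lim_null_comparison[OF _ LIMSEQ_inverse_real_of_nat])
        (use r(1) in \<open>auto intro!: always_eventually less_imp_le\<close>)
    then have "(\<lambda>n. (T ^^ r n) x) \<longlonglongrightarrow> w" using LIM_zero_iff by blast
    then show "w \<in> omega_limit T x"
      unfolding omega_limit_def using r(2) strict_mono_Suc_iff by blast
  qed
qed

lemma scrambled_minimal_mycielski:
  "\<exists>M (\<delta> :: nat \<Rightarrow> real). M \<subseteq> {0..1} \<and> closure M = {0..1} \<and> mycielski_set M \<and> (\<forall>n. 0 < \<delta> n)
    \<and> (\<forall>n\<ge>2. \<forall>x. (\<forall>i<n. x i \<in> M) \<and> inj_on x {..<n} \<longrightarrow> delta_li_yorke T (\<delta> n) n x)
    \<and> (\<forall>x\<in>M. omega_limit T x = core) \<and> (\<exists>C. cantor_set C \<and> C \<subseteq> M \<inter> core)"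
proof -
  have "\<exists>k\<ge>N. weave a k \<noteq> weave b k" if "a \<noteq> b" for a b N
    using weave_differ[OF that] .
  from spread_codes[OF cylinder_map_weave this]
  obtain M c where M: "M \<subseteq> {0..1}" "closure M = {0..1}" "mycielski_set M" "inj_on c M"
    "\<forall>u\<in>M. \<exists>K. \<forall>k\<ge>K. (T ^^ k) u = (T ^^ k) (woven (c u))"
    "\<exists>C. cantor_set C \<and> C \<subseteq> M \<and> C \<subseteq> range woven" by blast
  obtain K where K: "\<And>u k. u \<in> M \<Longrightarrow> k \<ge> K u \<Longrightarrow> (T ^^ k) u = (T ^^ k) (woven (c u))"
    using M(5) by metis
  \<comment> \<open>The bound is fixed by the tuple length before any tuple is given; half of it is
    used as \<delta> to obtain the strict inequality.\<close>
  have "\<forall>p::nat. \<exists>d>0. \<forall>a. inj_on a {..<p} \<longrightarrow> (\<forall>N. \<exists>k\<ge>N. \<forall>i<p. \<forall>j<p. i \<noteq> j \<longrightarrow>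
    d \<le> \<bar>(T ^^ k) (woven (a i)) - (T ^^ k) (woven (a j))\<bar>)"
    by (rule allI, rule woven_separated)
  from choice[OF this] obtain d where "\<forall>p::nat. 0 < d p \<and> (\<forall>a. inj_on a {..<p} \<longrightarrow>
    (\<forall>N. \<exists>k\<ge>N. \<forall>i<p. \<forall>j<p. i \<noteq> j \<longrightarrow>
      d p \<le> \<bar>(T ^^ k) (woven (a i)) - (T ^^ k) (woven (a j))\<bar>))"
    by (elim exE)
  then have d: "d p > 0" "inj_on a {..<p} \<Longrightarrow> \<exists>k\<ge>N. \<forall>i<p. \<forall>j<p. i \<noteq> j \<longrightarrow>
    d p \<le> \<bar>(T ^^ k) (woven (a i)) - (T ^^ k) (woven (a j))\<bar>" for p :: nat and a N
    by simp_all
  have "delta_li_yorke T (d n / 2) n x"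
    if n: "2 \<le> n" and x: "\<forall>i<n. x i \<in> M" "inj_on x {..<n}" for n x
  proof -
    \<comment> \<open>From time \<open>L\<close> on, all points of the tuple follow the orbits of
      their woven points.\<close>
    define L where "L = Max ((\<lambda>i. K (x i)) ` {..<n})"
    have L: "(T ^^ k) (x i) = (T ^^ k) (woven (c (x i)))" if "i < n" "k \<ge> L" for i k
    proof -
      have "K (x i) \<le> L" unfolding L_def by (rule Max_ge) (use that in auto)
      then show ?thesis using K x(1) that by simp
    qed
    have inj: "inj_on (\<lambda>i. c (x i)) {..<n}"
      using comp_inj_on[OF x(2), of c] inj_on_subset[OF M(4), of "x ` {..<n}"] x(1)
      by (auto simp: o_def)
    show ?thesis
    proof (rule delta_li_yorkeI[OF n])
      show "d n / 2 < d n" using d(1)[of n] by simp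
      show "\<exists>k\<ge>N. \<forall>i<n. \<forall>j<n. \<bar>(T ^^ k) (x i) - (T ^^ k) (x j)\<bar> < e" if "0 < e" for e N
      proof -
        obtain k where "k \<ge> max N L" "\<forall>a b. \<bar>(T ^^ k) (woven a) - (T ^^ k) (woven b)\<bar> < e"
          using woven_proximal[OF \<open>0 < e\<close>] by blast
        then show ?thesis using L by (intro exI[of _ k]) auto
      qed
      show "\<exists>k\<ge>N. \<forall>i<n. \<forall>j<n. i \<noteq> j \<longrightarrow> d n \<le> \<bar>(T ^^ k) (x i) - (T ^^ k) (x j)\<bar>" for N
      proof -
        obtain k where "k \<ge> max N L" "\<forall>i<n. \<forall>j<n. i \<noteq> j \<longrightarrow>
            d n \<le> \<bar>(T ^^ k) (woven (c (x i))) - (T ^^ k) (woven (c (x j)))\<bar>"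
          using d(2)[OF inj] by blast
        then show ?thesis using L by (intro exI[of _ k]) auto
      qed
    qed
  qed
  moreover have "\<forall>x\<in>M. omega_limit T x = core" using K omega_limit_eq_core by blast
  moreover have "\<exists>C. cantor_set C \<and> C \<subseteq> M \<inter> core" using M(6) woven_in_core by fast
  ultimately show ?thesis using M(1-3) d(1)
    by (intro exI[of _ M] exI[of _ "\<lambda>n. d n / 2"]) simp
qed

end

subsection \<open>Points with dense orbit\<close>

text \<open>The default from 1/4 to 1/2 replaces missing or improper entries, so every target is a
  nondegenerate interval inside the open unit interval, as covering demands.\<close>

definition target :: "nat \<Rightarrow> (nat \<Rightarrow> bool) \<Rightarrow> real set" where
  "target k a = (let (p, q) = (case lookup (table k) a of Some (p, q) \<Rightarrow>
       if 0 < p \<and> p < q \<and> q < 1 then (p, q) else (1/4, 1/2) | None \<Rightarrow> (1/4, 1/2 :: rat))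
     in {of_rat p..of_rat q})"

lemma target_eq:
  assumes "lookup (table k) a = Some (p, q)" "0 < p" "p < q" "q < 1"
  shows "target k a = {of_rat p..of_rat q}"
  using assms by (simp add: target_def)

lemma target_interval: "\<exists>u v. 0 < u \<and> u < v \<and> v < 1 \<and> target k a = {u..v}"
proof -
  obtain p q :: rat where pq: "0 < p" "p < q" "q < 1" "target k a = {of_rat p..of_rat q}"
  proof (cases "\<exists>p q :: rat. 0 < p \<and> p < q \<and> q < 1 \<and> lookup (table k) a = Some (p, q)")
    case True
    then show ?thesis using target_eq that by blast
  next
    case False
    then have "target k a = {of_rat (1/4)..of_rat (1/2)}"
      by (auto simp: target_def split: option.splits prod.splits if_splits)
    then show ?thesis by (rule that[rotated 3]) simp_all
  qed
  have "(of_rat 0::real) < of_rat p" "(of_rat p::real) < of_rat q" "(of_rat q::real) < of_rat 1"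
    using pq(1-3) by (simp_all only: of_rat_less)
  then show ?thesis using pq(4) by (intro exI[of _ "of_rat p"] exI[of _ "of_rat q"]) simp
qed

lemma closed_interval_target: "closed_interval (target k a)"
  unfolding closed_interval_def using target_interval[of k a] by force

text \<open>With finitely many targets per stage, one waiting time can serve all codes.\<close>

lemma finite_range_target: "finite (range (target k))"
proof -
  let ?f = "\<lambda>o'. let (p, q) = (case o' of Some (p, q) \<Rightarrow>
       if 0 < p \<and> p < q \<and> q < 1 then (p, q) else (1/4, 1/2) | None \<Rightarrow> (1/4, 1/2 :: rat))
     in {of_rat p..of_rat q :: real}"
  have "range (target k) = ?f ` range (lookup (table k))"
    unfolding target_def image_image ..
  moreover have "finite (?f ` range (lookup (table k)))" by (intro finite_imageI finite_range_lookup)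
  ultimately show ?thesis by (simp only:)
qed

lemma target_cylinder: "\<exists>N. \<forall>a b. agree N a b \<longrightarrow> target k a = target k b"
proof (intro exI allI impI)
  fix a b assume "agree (fst (table k :: (rat \<times> rat) table)) a b"
  then show "target k a = target k b" unfolding target_def by (simp only: lookup_agree)
qed

lemma target_const:
  fixes p q :: rat
  assumes "0 < p" "p < q" "q < 1"
  shows "\<exists>k\<ge>N. \<forall>a. target k a = {of_rat p..of_rat q}"
proof -
  obtain k where k: "k \<ge> N" "\<forall>a. lookup (table k) a = Some (p, q)" using table_const by blast
  have "target k a = {of_rat p..of_rat q}" for a by (rule target_eq) (use k(2) assms in auto)
  then show ?thesis using k(1) by blast
qed

lemma target_separates:
  fixes a :: "nat \<Rightarrow> nat \<Rightarrow> bool" and p q :: "nat \<Rightarrow> rat"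
  assumes inj: "inj_on a {..<n}" and pq: "\<And>i. i < n \<Longrightarrow> 0 < p i \<and> p i < q i \<and> q i < 1"
  shows "\<exists>k\<ge>N. \<forall>i<n. target k (a i) = {of_rat (p i)..of_rat (q i)}"
proof -
  from table_separates[OF inj, of N "\<lambda>i. (p i, q i)"]
  obtain k where k: "k \<ge> N" "\<forall>i<n. lookup (table k) (a i) = Some (p i, q i)" by blast
  have "target k (a i) = {of_rat (p i)..of_rat (q i)}" if "i < n" for i
    by (rule target_eq) (use k(2) pq[OF that] that in auto)
  then show ?thesis using k(1) by blast
qed

context mixing_interval_map
begin

text \<open>Covering from \<open>V k\<close> allows a piece to start at stage \<open>k\<close>
  inside \<open>V k\<close>, while covering between consecutive targets lets any piece continue on
  the same schedule.\<close>

lemma times_exist: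
  assumes V: "\<And>k. \<exists>u v. 0 < u \<and> u < v \<and> v < 1 \<and> V k = {u..v}"
  shows "\<exists>t :: nat \<Rightarrow> nat. (\<forall>k. k \<le> t k) \<and> (\<forall>k a. target k a \<subseteq> (T ^^ t k) ` V k)
    \<and> (\<forall>k a b. t k \<le> t (Suc k) \<and> target (Suc k) b \<subseteq> (T ^^ (t (Suc k) - t k)) ` target k a)"
proof -
  have cov: "\<forall>\<^sub>F n in sequentially. S' \<subseteq> (T ^^ n) ` S"
    if S: "\<exists>u v. 0 < u \<and> u < v \<and> v < 1 \<and> S = {u..v}" "\<exists>u v. 0 < u \<and> u < v \<and> v < 1 \<and> S' = {u..v}"
    for S S' :: "real set"
  proof -
    obtain u v a b where *: "0 < u" "u < v" "v < 1" "S = {u..v}" "0 < a" "b < 1" "S' = {a..b}"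
      using S by blast
    then show ?thesis using eventually_covers[of u v a b] by simp
  qed
  let ?E = "\<lambda>k n. \<forall>S\<in>insert (V k) (range (target (k - 1))). \<forall>S'\<in>range (target k). S' \<subseteq> (T ^^ n) ` S"
  have "\<forall>\<^sub>F n in sequentially. ?E k n" for k
  proof (intro eventually_ball_finite ballI)
    fix S S' assume "S \<in> insert (V k) (range (target (k - 1)))" "S' \<in> range (target k)"
    then show "\<forall>\<^sub>F n in sequentially. S' \<subseteq> (T ^^ n) ` S"
      using V target_interval by (intro cov) auto
  qed (use finite_range_target in auto)
  then have "\<forall>k. \<exists>N. \<forall>n\<ge>N. ?E k n" unfolding eventually_sequentially by blast
  from choice[OF this] obtain r where r: "\<And>k n. n \<ge> r k \<Longrightarrow> ?E k n" by blast
  \<comment> \<open>Partial sums make the gap before stage \<open>k\<close> exceed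
    \<open>r k\<close>, and keep \<open>t k\<close> itself above \<open>r k\<close>; the added ones
    give \<open>k \<le> t k\<close>.\<close>
  define t where "t k = (\<Sum>j\<le>k. r j + 1)" for k
  have t: "t (Suc k) = t k + (r (Suc k) + 1)" "r k \<le> t k" for k
    unfolding t_def by (cases k; simp)+
  have "k \<le> t k" for k by (induction k) (simp_all add: t(1))
  moreover have "target k a \<subseteq> (T ^^ t k) ` V k" for k a using r[OF t(2)] by blast
  moreover have "target (Suc k) b \<subseteq> (T ^^ (t (Suc k) - t k)) ` target k a" for k a b
    using r[of "Suc k" "t (Suc k) - t k"] t(1)[of k] by simp
  ultimately show ?thesis using t(1) by (intro exI[of _ t]) simp
qed

lemma scheduled_points:
  assumes t: "\<And>k. k \<le> t k" "\<And>k a b. t k \<le> t (Suc k) \<and>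
      target (Suc k) b \<subseteq> (T ^^ (t (Suc k) - t k)) ` target k a"
    and V: "closed_interval V" and start: "\<And>a. target i a \<subseteq> (T ^^ t i) ` V"
  shows "\<exists>g. cylinder_continuous g \<and> (\<forall>a. g a \<in> V) \<and> (\<forall>k\<ge>i. \<forall>a. (T ^^ t k) (g a) \<in> target k a)"
proof -
  define F where "F n = T ^^ t (i + n)" for n
  define K where "K n = target (i + n)" for n
  have F: "continuous_on {0..1} (F n)" for n unfolding F_def by (rule cont_iter)
  have K: "closed_interval (K n a)" for n a unfolding K_def by (rule closed_interval_target)
  have K0: "K 0 a \<subseteq> F 0 ` V" for a using start by (simp add: K_def F_def)
  have step: "K (Suc n) a \<subseteq> F (Suc n) ` S" if S: "F n ` S = K n a" for n a S
  proof -
    let ?d = "t (Suc (i + n)) - t (i + n)"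
    have "t (Suc (i + n)) = ?d + t (i + n)" using t(2)[of "i + n"] by simp
    then have "F (Suc n) ` S = (T ^^ ?d) ` (F n ` S)"
      unfolding F_def add_Suc_right by (metis funpow_add image_comp)
    then show ?thesis using t(2)[of "i + n" a a] unfolding S by (simp add: K_def)
  qed
  have K_cyl: "\<exists>N. \<forall>a b. agree N a b \<longrightarrow> K n a = K n b" for n
    unfolding K_def by (rule target_cylinder)
  note R = refine[where F = F and K = K, OF F V K K0 step]
  let ?R = "refine F K V"
  have hit: "(T ^^ t (i + n)) ` ?R (Suc n) a = target (i + n) a" for n a
    using R(3)[of n a] by (simp only: F_def K_def)
  have "\<exists>n s. s \<ge> N \<and> (\<forall>a. \<not> {1/5..4/5} \<subseteq> (T ^^ s) ` ?R n a)" for N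
  proof -
    \<comment> \<open>Stages where all codes share the target from 1/4 to 1/2 recur forever; such a
      target misses 4/5, which forces the intervals to shrink.\<close>
    obtain k where k: "k \<ge> max N i" "\<forall>a. target k a = {of_rat (1/4)..of_rat (1/2)}"
      using target_const[of "1/4" "1/2" "max N i"] by auto
    have "\<not> {1/5..4/5} \<subseteq> (T ^^ t k) ` ?R (Suc (k - i)) a" for a
    proof -
      have "(T ^^ t k) ` ?R (Suc (k - i)) a = {1/4..1/2}"
        using hit[of "k - i" a] k by (simp add: of_rat_divide del: refine.simps)
      moreover have "4/5 \<in> {1/5..4/5::real}" "4/5 \<notin> {1/4..1/2::real}" by auto
      ultimately show ?thesis by blast
    qed
    moreover have "N \<le> t k" using k(1) t(1)[of k] by simp
    ultimately show ?thesis by blast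
  qed
  from nested_intervals_limit[OF R(1,2) refine_cylinder[OF K_cyl] this]
  obtain g where g: "cylinder_continuous g" "\<And>a n. g a \<in> ?R n a" by metis
  have "(T ^^ t k) (g a) \<in> target k a" if "k \<ge> i" for k a
  proof -
    have "(T ^^ t (i + (k - i))) (g a) \<in> (T ^^ t (i + (k - i))) ` ?R (Suc (k - i)) a"
      using g(2) by blast
    then have "(T ^^ t (i + (k - i))) (g a) \<in> target (i + (k - i)) a" unfolding hit .
    then show ?thesis using that by simp
  qed
  moreover have "g a \<in> V" for a using g(2)[of a 0] by simp
  ultimately show ?thesis using g(1) by blast
qed

text \<open>All pieces share one schedule \<open>t\<close>, so that points from different pieces can
  be compared at the same times.\<close>

lemma scheduled_mycielski:
  "\<exists>M c (t :: nat \<Rightarrow> nat). M \<subseteq> {0..1} \<and> closure M = {0..1} \<and> mycielski_set M \<and> inj_on c M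
    \<and> (\<forall>k. k \<le> t k) \<and> (\<forall>u\<in>M. \<exists>i. \<forall>k\<ge>i. (T ^^ t k) u \<in> target k (c u))"
proof -
  define V :: "nat \<Rightarrow> real set" where "V i = (let (p, q) = (from_nat i :: rat \<times> rat) in
      if 0 < p \<and> p < q \<and> q < 1 then {of_rat p..of_rat q} else {1/4..1/2})" for i
  have V: "\<exists>u v. 0 < u \<and> u < v \<and> v < 1 \<and> V k = {u..v}" for k
  proof -
    obtain p q :: rat where k: "from_nat k = (p, q)" by fastforce
    show ?thesis
    proof (cases "0 < p \<and> p < q \<and> q < 1")
      case True
      then have "(of_rat 0::real) < of_rat p" "(of_rat p::real) < of_rat q" "(of_rat q::real) < of_rat 1"
        by (simp_all only: of_rat_less)
      then show ?thesis using True k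
        by (intro exI[of _ "of_rat p"] exI[of _ "of_rat q"]) (simp add: V_def)
    next
      case False
      then show ?thesis using k by (intro exI[of _ "1/4"] exI[of _ "1/2"]) (auto simp: V_def)
    qed
  qed
  from times_exist[of V, OF V] obtain t :: "nat \<Rightarrow> nat" where "\<forall>k. k \<le> t k"
    "\<forall>k a. target k a \<subseteq> (T ^^ t k) ` V k"
    "\<forall>k a b. t k \<le> t (Suc k) \<and> target (Suc k) b \<subseteq> (T ^^ (t (Suc k) - t k)) ` target k a"
    by (elim exE conjE) (rule that)
  then have t: "k \<le> t k" "target k a \<subseteq> (T ^^ t k) ` V k"
    "t k \<le> t (Suc k) \<and> target (Suc k) b \<subseteq> (T ^^ (t (Suc k) - t k)) ` target k a" for k a b
    by simp_all
  have ciV: "closed_interval (V k)" for k unfolding closed_interval_def using V[of k] by force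
  have "\<forall>i. \<exists>g. cylinder_continuous g \<and> (\<forall>a. g a \<in> V i) \<and> (\<forall>k\<ge>i. \<forall>a. (T ^^ t k) (g a) \<in> target k a)"
    by (intro allI scheduled_points t ciV)
  from choice[OF this] obtain g where g: "\<And>i. cylinder_continuous (g i)" "\<And>i a. g i a \<in> V i"
    "\<And>i k a. k \<ge> i \<Longrightarrow> (T ^^ t k) (g i a) \<in> target k a" by blast
  have inj: "inj (g i)" for i
  proof (rule injI, rule ccontr)
    fix a b assume ab: "g i a = g i b" "a \<noteq> b"
    \<comment> \<open>Some late stage assigns the two codes disjoint targets.\<close>
    have "inj_on (\<lambda>j::nat. if j = 0 then a else b) {..<2}" using ab(2) by (auto simp: inj_on_def)
    from target_separates[OF this, of "\<lambda>j. if j = 0 then 1/5 else 3/5"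
        "\<lambda>j. if j = 0 then 2/5 else 4/5" i]
    have "\<exists>k\<ge>i. \<forall>j<2::nat. target k (if j = 0 then a else b) =
        {of_rat (if j = 0 then 1/5 else 3/5)..of_rat (if j = 0 then 2/5 else 4/5)}" by simp
    then obtain k where k: "k \<ge> i" "\<forall>j<2::nat. target k (if j = 0 then a else b) =
        {of_rat (if j = 0 then 1/5 else 3/5)..of_rat (if j = 0 then 2/5 else 4/5)}" by blast
    have "target k a = {1/5..2/5}" "target k b = {3/5..4/5}"
      using k(2)[rule_format, of 0] k(2)[rule_format, of 1] by (simp_all add: of_rat_divide)
    then show False using g(3)[OF k(1), of a] g(3)[OF k(1), of b] ab(1) by auto
  qed
  have unit: "g i a \<in> {0..1}" for i a using g(2)[of i a] closed_intervalD(4)[OF ciV[of i]] by blast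
  have dense: "\<exists>i. \<forall>a. g i a \<in> {of_rat p..of_rat q}" if "0 < p" "p < q" "q < 1" for p q :: rat
  proof -
    have "V (to_nat (p, q)) = {of_rat p..of_rat q}" using that by (simp add: V_def)
    then show ?thesis using g(2) by metis
  qed
  have "\<exists>M c. M \<subseteq> {0..1} \<and> closure M = {0..1} \<and> mycielski_set M \<and> inj_on c M
    \<and> (\<forall>u\<in>M. \<exists>i. u = g i (c u)) \<and> (\<forall>i. \<exists>C. cantor_set C \<and> C \<subseteq> M \<and> C \<subseteq> range (g i))"
    by (rule dense_mycielski_union[OF g(1) inj unit dense])
  then obtain M c where M: "M \<subseteq> {0..1}" "closure M = {0..1}" "mycielski_set M" "inj_on c M"
    "\<forall>u\<in>M. \<exists>i. u = g i (c u)" by blast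
  have "\<forall>u\<in>M. \<exists>i. \<forall>k\<ge>i. (T ^^ t k) u \<in> target k (c u)" using M(5) g(3) by metis
  then show ?thesis using M(1-4) t(1) by blast
qed

lemma scrambled_transitive_mycielski:
  "\<exists>M (\<delta> :: nat \<Rightarrow> real). M \<subseteq> {0..1} \<and> closure M = {0..1} \<and> mycielski_set M \<and> (\<forall>n. 0 < \<delta> n)
    \<and> (\<forall>n\<ge>2. \<forall>x. (\<forall>i<n. x i \<in> M) \<and> inj_on x {..<n} \<longrightarrow> delta_li_yorke T (\<delta> n) n x)
    \<and> (\<forall>x\<in>M. closure (orbit T x) = {0..1})"
proof -
  obtain M c and t :: "nat \<Rightarrow> nat" where M: "M \<subseteq> {0..1}" "closure M = {0..1}" "mycielski_set M"
    "inj_on c M" and t: "\<And>k. k \<le> t k"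
    and vis: "\<forall>u\<in>M. \<exists>i. \<forall>k\<ge>i. (T ^^ t k) u \<in> target k (c u)"
    using scheduled_mycielski by metis
  from bchoice[OF vis] obtain K where K: "\<And>u k. u \<in> M \<Longrightarrow> k \<ge> K u \<Longrightarrow> (T ^^ t k) u \<in> target k (c u)"
    by blast
  have "closure (orbit T x) = {0..1}" if x: "x \<in> M" for x
  proof (rule closure_eq_unit_interval)
    show "orbit T x \<subseteq> {0..1}" unfolding orbit_def using iter_maps M(1) x by blast
    fix p q :: rat assume "0 < p" "p < q" "q < 1"
    from target_const[OF this, of "K x"] obtain k
      where "k \<ge> K x" "\<forall>a. target k a = {of_rat p..of_rat q}" by blast
    then have "(T ^^ t k) x \<in> {of_rat p..of_rat q}" using K[OF x] by blast
    moreover have "(T ^^ t k) x \<in> orbit T x" unfolding orbit_def by blast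
    ultimately show "orbit T x \<inter> {of_rat p..of_rat q} \<noteq> {}" by blast
  qed
  moreover have "delta_li_yorke T (1 / (2 * (2 * real n + 1))) n x"
    if n: "2 \<le> n" and x: "\<forall>i<n. x i \<in> M" "inj_on x {..<n}" for n x
  proof -
    define L where "L = Max ((\<lambda>i. K (x i)) ` {..<n})"
    have L: "(T ^^ t k) (x i) \<in> target k (c (x i))" if "i < n" "k \<ge> L" for i k
    proof -
      have "K (x i) \<le> L" unfolding L_def by (rule Max_ge) (use that in auto)
      then show ?thesis using K x(1) that by simp
    qed
    have inj: "inj_on (\<lambda>i. c (x i)) {..<n}"
      using comp_inj_on[OF x(2), of c] inj_on_subset[OF M(4), of "x ` {..<n}"] x(1)
      by (auto simp: o_def)
    let ?D = "2 * real n + 1"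
    show ?thesis
    proof (rule delta_li_yorkeI[OF n])
      show "1 / (2 * ?D) < 1 / ?D" by (simp add: field_simps)
      show "\<exists>k\<ge>N. \<forall>i<n. \<forall>j<n. \<bar>(T ^^ k) (x i) - (T ^^ k) (x j)\<bar> < e" if e: "0 < e" for e N
      proof -
        \<comment> \<open>A common target starting at 1/4 and shorter than \<open>e\<close> brings
          all points of the tuple together.\<close>
        obtain q :: rat where q: "1/4 < real_of_rat q" "real_of_rat q < min 1 (1/4 + e)"
          using of_rat_dense[of "1/4" "min 1 (1/4 + e)"] e by auto
        have "real_of_rat (1/4) < of_rat q" "real_of_rat q < of_rat 1"
          using q by (simp_all add: of_rat_divide)
        then have "1/4 < q" "q < 1" by (simp_all only: of_rat_less)
        from target_const[OF _ this, of "max N L"] obtain k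
          where k: "k \<ge> max N L" "\<forall>a. target k a = {of_rat (1/4)..of_rat q}" by auto
        have "\<bar>(T ^^ t k) (x i) - (T ^^ t k) (x j)\<bar> < e" if "i < n" "j < n" for i j
          using L[of i k] L[of j k] that k q(2) by (auto simp: of_rat_divide)
        moreover have "N \<le> t k" using k(1) t[of k] by simp
        ultimately show ?thesis by blast
      qed
      show "\<exists>k\<ge>N. \<forall>i<n. \<forall>j<n. i \<noteq> j \<longrightarrow> 1 / ?D \<le> \<bar>(T ^^ k) (x i) - (T ^^ k) (x j)\<bar>" for N
      proof -
        \<comment> \<open>Divide the unit interval into \<open>2 * n + 1\<close> equal cells and
          send point \<open>i\<close> to the cell after the first \<open>2 * i + 1\<close>. A free
          cell remains between any two chosen cells, whence the distance
          \<open>1 / ?D\<close>.\<close>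
        let ?p = "\<lambda>i. of_nat (2 * i + 1) / of_nat (2 * n + 1) :: rat"
        let ?q = "\<lambda>i. of_nat (2 * i + 2) / of_nat (2 * n + 1) :: rat"
        have "0 < ?p i \<and> ?p i < ?q i \<and> ?q i < 1" if "i < n" for i
        proof (intro conjI)
          show "0 < ?p i" by (intro divide_pos_pos) (simp_all only: of_nat_0_less_iff)
          show "?p i < ?q i" by (intro divide_strict_right_mono) (simp_all only: of_nat_0_less_iff of_nat_less_iff)
          have "2 * i + 2 < 2 * n + 1" using that by simp
          then have "(of_nat (2 * i + 2) :: rat) < of_nat (2 * n + 1)" by (simp only: of_nat_less_iff)
          then show "?q i < 1" by (subst divide_less_eq_1_pos) (simp_all only: of_nat_0_less_iff)
        qed
        from target_separates[where p = ?p and q = ?q and N = "max N L", OF inj this] obtain k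
          where k: "k \<ge> max N L" "\<forall>i<n. target k (c (x i)) = {of_rat (?p i)..of_rat (?q i)}" by auto
        have iv: "(2 * real i + 1) / ?D \<le> (T ^^ t k) (x i)" "(T ^^ t k) (x i) \<le> (2 * real i + 2) / ?D"
          if "i < n" for i
        proof -
          have "(T ^^ t k) (x i) \<in> {of_rat (?p i)..of_rat (?q i)}"
            using L[of i k] that k by simp
          moreover have "real_of_rat (?p i) = (2 * real i + 1) / ?D" "real_of_rat (?q i) = (2 * real i + 2) / ?D"
            by (simp_all add: of_rat_divide of_rat_add of_rat_mult add.commute)
          ultimately show "(2 * real i + 1) / ?D \<le> (T ^^ t k) (x i)"
            "(T ^^ t k) (x i) \<le> (2 * real i + 2) / ?D" by simp_all
        qed
        have lt: "1 / ?D \<le> (T ^^ t k) (x j) - (T ^^ t k) (x i)" if "i < n" "j < n" "i < j" for i j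
        proof -
          have "real i + 1 \<le> real j" using that by simp
          then have "1 / ?D \<le> ((2 * real j + 1) - (2 * real i + 2)) / ?D"
            by (intro divide_right_mono) auto
          also have "\<dots> = (2 * real j + 1) / ?D - (2 * real i + 2) / ?D" by (rule diff_divide_distrib)
          finally show ?thesis using iv(1)[OF that(2)] iv(2)[OF that(1)] by linarith
        qed
        have "1 / ?D \<le> \<bar>(T ^^ t k) (x i) - (T ^^ t k) (x j)\<bar>" if "i < n" "j < n" "i \<noteq> j" for i j
          using lt[of i j] lt[of j i] that by (cases "i < j") auto
        moreover have "N \<le> t k" using k(1) t[of k] by simp
        ultimately show ?thesis by blast
      qed
    qed
  qed
  ultimately show ?thesis using M(1-3)
    by (intro exI[of _ M] exI[of _ "\<lambda>n. 1 / (2 * (2 * real n + 1))"]) auto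
qed

end

section \<open>The three dense Mycielski sets together\<close>

theorem mainTheorem11:
  fixes T :: "real \<Rightarrow> real"
  assumes "continuous_on {0..1} T" and "T ` {0..1} \<subseteq> {0..1}"
    and "topologically_mixing T"
  shows "\<exists>M1 M2 M3 (\<delta> :: nat \<Rightarrow> real).
     (\<forall>M\<in>{M1, M2, M3}. M \<subseteq> {0..1} \<and> closure M = {0..1} \<and> mycielski_set M)
   \<and> (\<forall>n\<ge>2. \<delta> n > 0)
   \<and> (\<forall>M\<in>{M1, M2}. \<forall>n\<ge>2. \<forall>x. (\<forall>i<n. x i \<in> M) \<and> inj_on x {..<n}
          \<longrightarrow> delta_li_yorke T (\<delta> n) n x)
   \<and> (\<forall>x\<in>M1. closure (orbit T x) = {0..1})
   \<and> (\<exists>A. minimal_set T A \<and> cantor_set A \<and> (\<forall>x\<in>M2. omega_limit T x = A)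
          \<and> (\<exists>C. cantor_set C \<and> C \<subseteq> M2 \<inter> A))
   \<and> (\<forall>x\<in>M3. \<forall>y\<in>M3. \<not> li_yorke_pair T x y)"
proof -
  interpret mixing_interval_map T using assms by unfold_locales
  obtain m h where "coded_interval_map T m h" using coding_exists by blast
  then interpret coded_interval_map T m h .
  obtain M1 and \<delta>1 :: "nat \<Rightarrow> real" where
    M1: "M1 \<subseteq> {0..1}" "closure M1 = {0..1}" "mycielski_set M1" "\<forall>n. 0 < \<delta>1 n"
      "\<forall>n\<ge>2. \<forall>x. (\<forall>i<n. x i \<in> M1) \<and> inj_on x {..<n} \<longrightarrow> delta_li_yorke T (\<delta>1 n) n x"
      "\<forall>x\<in>M1. closure (orbit T x) = {0..1}"
    using scrambled_transitive_mycielski by (elim exE conjE) (rule that)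
  obtain M2 and \<delta>2 :: "nat \<Rightarrow> real" where
    M2: "M2 \<subseteq> {0..1}" "closure M2 = {0..1}" "mycielski_set M2" "\<forall>n. 0 < \<delta>2 n"
      "\<forall>n\<ge>2. \<forall>x. (\<forall>i<n. x i \<in> M2) \<and> inj_on x {..<n} \<longrightarrow> delta_li_yorke T (\<delta>2 n) n x"
      "\<forall>x\<in>M2. omega_limit T x = core" "\<exists>C. cantor_set C \<and> C \<subseteq> M2 \<inter> core"
    using scrambled_minimal_mycielski by blast
  obtain M3 where M3: "M3 \<subseteq> {0..1}" "closure M3 = {0..1}" "mycielski_set M3"
      "\<forall>x\<in>M3. \<forall>y\<in>M3. \<not> li_yorke_pair T x y"
    using distal_mycielski by (elim exE conjE) (rule that)
  \<comment> \<open>One sequence of constants must serve both scrambled sets, hence the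
    minimum.\<close>
  show ?thesis
  proof (rule exI[of _ M1], rule exI[of _ M2], rule exI[of _ M3],
      rule exI[of _ "\<lambda>n. min (\<delta>1 n) (\<delta>2 n)"], intro conjI)
    show "\<forall>M\<in>{M1, M2, M3}. M \<subseteq> {0..1} \<and> closure M = {0..1} \<and> mycielski_set M"
      using M1(1-3) M2(1-3) M3(1-3) by simp
    show "\<forall>n\<ge>2. 0 < min (\<delta>1 n) (\<delta>2 n)" using M1(4) M2(4) by simp
    show "\<forall>M\<in>{M1, M2}. \<forall>n\<ge>2. \<forall>x. (\<forall>i<n. x i \<in> M) \<and> inj_on x {..<n}
        \<longrightarrow> delta_li_yorke T (min (\<delta>1 n) (\<delta>2 n)) n x"
    proof (intro ballI allI impI)
      fix M and n :: nat and x :: "nat \<Rightarrow> real"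
      assume "M \<in> {M1, M2}" "2 \<le> n" "(\<forall>i<n. x i \<in> M) \<and> inj_on x {..<n}"
      then have "delta_li_yorke T (\<delta>1 n) n x \<or> delta_li_yorke T (\<delta>2 n) n x"
        using M1(5) M2(5) by blast
      then show "delta_li_yorke T (min (\<delta>1 n) (\<delta>2 n)) n x"
        using delta_li_yorke_mono min.cobounded1 min.cobounded2 by blast
    qed
    show "\<forall>x\<in>M1. closure (orbit T x) = {0..1}" by (rule M1(6))
    show "\<exists>A. minimal_set T A \<and> cantor_set A \<and> (\<forall>x\<in>M2. omega_limit T x = A)
        \<and> (\<exists>C. cantor_set C \<and> C \<subseteq> M2 \<inter> A)"
      using minimal_core cantor_core M2(6,7) by blast
    show "\<forall>x\<in>M3. \<forall>y\<in>M3. \<not> li_yorke_pair T x y" by (rule M3(4))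
  qed
qed

end
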